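(* Let $K\ge1$ and $f\in\mathcal{S}_{H_2}(K,G)$, where $G$ is a bounded Pommerenke interior domain. If there are constants $\delta_2\in(0,1)$ and $C_5>0$ such that, for each $\zeta\in\partial\mathbb{D}$ and for $0\le\rho_1\le\rho_2<1$, $$\|D_f(\rho_2\zeta)\|\le C_5\left(\frac{1-\rho_2}{1-\rho_1}\right)^{\delta_2-1}\|D_f(\rho_1\zeta)\|,$$ then $$\sup_{\zeta\in\mathbb{D}}\frac{1}{2\pi}\int_{\partial\mathbb{D}}\frac{\|D_f(\xi)\|}{\|D_f(\zeta)\|}\,\frac{1-|\zeta|^2}{|\xi-\zeta|^2}\,|d\xi|<\infty.$$
   Context: $\mathbb{D}=\{z\in\mathbb{C}:|z|<1\}$, $\mathbb{D}_r=\{z:|z|<r\}$. $\mathcal{S}_H$ is the family of sense-preserving harmonic univalent mappings $f=h+\overline{g}$ in $\mathbb{D}$, with $h,g$ analytic, $h(0)=g(0)=0$, $h'(0)=1$. $\mathcal{S}_{H_2}$ is the class of all $f=h+\overline g\in\mathcal{S}_H$ satisfying $$\sup_{z\in\mathbb{D}}\left|(1-|z|^2)\frac{h''(z)}{h'(z)}-2\overline z\right|<4.$$ Write $\|D_f\|=|f_z|+|f_{\overline z}|$. A sense-preserving homeomorphism $f$ of class $W^{1,2}_{loc}$ between domains is $K$-quasiconformal if $\|D_f(z)\|^2\le K\big||f_z|^2-|f_{\overline z}|^2\big|$. $\mathcal{S}_{H_2}(K,G)$ is the set of $K$-quasiconformal $f\in\mathcal{S}_{H_2}$ with $f(\mathbb{D})=G$.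 Pommerenke interior domain: let $f\in\mathcal{S}_H$ be $K$-quasiconformal with $f(\mathbb{D})=G$. For $0<r<1$ let $G_r=f(\mathbb{D}_r)$; for distinct $w_1,w_2\in f(\partial\mathbb{D}_r)$ let $\gamma_r[w_1,w_2]$ be the smaller (shorter) subarc of $f(\partial\mathbb{D}_r)$ between $w_1$ and $w_2$, $\ell(\gamma_r[w_1,w_2])$ its length, and $d_{G_r}(w_1,w_2)=\inf_\Gamma\operatorname{diam}\Gamma$, where $\Gamma$ runs through all arcs from $w_1$ to $w_2$ that lie in $G_r$ except for their endpoints. $G$ is a Pommerenke interior domain (with respect to $f$) if $$\sup_{0<r<1}\ \sup_{w_1,w_2}\frac{\ell(\gamma_r[w_1,w_2])}{d_{G_r}(w_1,w_2)}<\infty,$$ and a bounded Pommerenke interior domain if in addition $G$ is bounded. For $\xi\in\partial\mathbb{D}$, $\|D_f(\xi)\|$ denotes the radial limit $\lim_{r\to1^-}\|D_f(r\xi)\|$ (defined almost everywhere). *)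

theory Defs
  imports "HOL-Complex_Analysis.Complex_Analysis"
begin

definition wirtinger_z :: "(complex \<Rightarrow> complex) \<Rightarrow> complex \<Rightarrow> complex" where
  "wirtinger_z f z =
     (frechet_derivative f (at z) 1 - \<i> * frechet_derivative f (at z) \<i>) / 2"

definition wirtinger_zbar :: "(complex \<Rightarrow> complex) \<Rightarrow> complex \<Rightarrow> complex" where
  "wirtinger_zbar f z =
     (frechet_derivative f (at z) 1 + \<i> * frechet_derivative f (at z) \<i>) / 2"

definition norm_D :: "(complex \<Rightarrow> complex) \<Rightarrow> complex \<Rightarrow> real" where
  "norm_D f z = norm (wirtinger_z f z) + norm (wirtinger_zbar f z)"

definition jacobian :: "(complex \<Rightarrow> complex) \<Rightarrow> complex \<Rightarrow> real" where
  "jacobian f z = (norm (wirtinger_z f z))\<^sup>2 - (norm (wirtinger_zbar f z))\<^sup>2"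

text \<open>The radial limit is taken in the extended nonnegative reals, so an infinite limit
  is not hidden. \<^const>\<open>Lim\<close> is unspecified at points where there is no limit.\<close>

definition radial_norm_D :: "(complex \<Rightarrow> complex) \<Rightarrow> complex \<Rightarrow> ennreal" where
  "radial_norm_D f \<xi> = Lim (at_left (1::real)) (\<lambda>r. ennreal (norm_D f (of_real r * \<xi>)))"


definition canonical_decomposition ::
    "(complex \<Rightarrow> complex) \<Rightarrow> (complex \<Rightarrow> complex) \<Rightarrow> (complex \<Rightarrow> complex) \<Rightarrow> bool" where
  "canonical_decomposition f h g \<longleftrightarrow>
     h holomorphic_on ball 0 1 \<and> g holomorphic_on ball 0 1 \<and>
     h 0 = 0 \<and> g 0 = 0 \<and> deriv h 0 = 1 \<and>
     (\<forall>z\<in>ball 0 1. f z = h z + cnj (g z))"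

text \<open>A harmonic (hence smooth) map is sense-preserving if its Jacobian is positive.\<close>

definition S_H :: "(complex \<Rightarrow> complex) set" where
  "S_H = {f. (\<exists>h g. canonical_decomposition f h g) \<and>
             inj_on f (ball 0 1) \<and> (\<forall>z\<in>ball 0 1. jacobian f z > 0)}"

text \<open>On the unit disk the map \<open>h\<close> is uniquely determined by \<open>f\<close>.\<close>

definition S_H2 :: "(complex \<Rightarrow> complex) set" where
  "S_H2 = {f \<in> S_H. \<exists>h g. canonical_decomposition f h g \<and>
             (SUP z\<in>ball 0 1.
                ereal (norm (of_real (1 - (norm z)\<^sup>2) * (deriv (deriv h) z / deriv h z)
                             - 2 * cnj z))) < 4}"


text \<open>Real-valued test functions on the plane: \<open>F m n\<close> is the partial derivative
  \<open>\<partial>\<^sub>x\<^sup>m \<partial>\<^sub>y\<^sup>n \<phi>\<close>.\<close>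

definition test_function :: "complex set \<Rightarrow> (complex \<Rightarrow> real) \<Rightarrow> bool" where
  "test_function \<Omega> \<phi> \<longleftrightarrow>
     (\<exists>F :: nat \<Rightarrow> nat \<Rightarrow> complex \<Rightarrow> real. F 0 0 = \<phi> \<and>
        (\<forall>m n z. (F m n has_derivative
                   (\<lambda>v. Re v * F (Suc m) n z + Im v * F m (Suc n) z)) (at z))) \<and>
     compact (closure {z. \<phi> z \<noteq> 0}) \<and> closure {z. \<phi> z \<noteq> 0} \<subseteq> \<Omega>"

definition L2_loc :: "complex set \<Rightarrow> (complex \<Rightarrow> complex) \<Rightarrow> bool" where
  "L2_loc \<Omega> u \<longleftrightarrow> set_borel_measurable lebesgue \<Omega> u \<and>
     (\<forall>C. compact C \<and> C \<subseteq> \<Omega> \<longrightarrow>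
        (\<integral>\<^sup>+z. ennreal ((norm (u z))\<^sup>2) * indicator C z \<partial>lebesgue) < \<infinity>)"

definition weak_derivative ::
    "complex set \<Rightarrow> complex \<Rightarrow> (complex \<Rightarrow> complex) \<Rightarrow> (complex \<Rightarrow> complex) \<Rightarrow> bool" where
  "weak_derivative \<Omega> v u p \<longleftrightarrow>
     (\<forall>\<phi>. test_function \<Omega> \<phi> \<longrightarrow>
        set_lebesgue_integral lebesgue \<Omega> (\<lambda>z. frechet_derivative \<phi> (at z) v *\<^sub>R u z) =
        - set_lebesgue_integral lebesgue \<Omega> (\<lambda>z. \<phi> z *\<^sub>R p z))"

definition W12_loc :: "complex set \<Rightarrow> (complex \<Rightarrow> complex) \<Rightarrow> bool" where
  "W12_loc \<Omega> u \<longleftrightarrow> L2_loc \<Omega> u \<and>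
     (\<exists>p q. L2_loc \<Omega> p \<and> L2_loc \<Omega> q \<and>
            weak_derivative \<Omega> 1 u p \<and> weak_derivative \<Omega> \<i> u q)"

definition sense_preserving_injection :: "complex set \<Rightarrow> (complex \<Rightarrow> complex) \<Rightarrow> bool" where
  "sense_preserving_injection \<Omega> f \<longleftrightarrow> continuous_on \<Omega> f \<and> inj_on f \<Omega> \<and>
     (\<forall>z r. 0 < r \<and> cball z r \<subseteq> \<Omega> \<longrightarrow> winding_number (f \<circ> circlepath z r) (f z) = 1)"

definition planar_domain :: "complex set \<Rightarrow> bool" where
  "planar_domain \<Omega> \<longleftrightarrow> open \<Omega> \<and> connected \<Omega> \<and> \<Omega> \<noteq> {}"

text \<open>A homeomorphism in \<open>W\<^sup>1\<^sup>,\<^sup>2\<^sub>l\<^sub>o\<^sub>c\<close> between planar domains is differentiable almost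
  everywhere, and its classical and weak derivatives agree almost everywhere, so the
  distortion inequality is stated with classical derivatives.\<close>

definition quasiconformal ::
    "real \<Rightarrow> complex set \<Rightarrow> complex set \<Rightarrow> (complex \<Rightarrow> complex) \<Rightarrow> bool" where
  "quasiconformal K \<Omega> \<Omega>' f \<longleftrightarrow>
     planar_domain \<Omega> \<and> planar_domain \<Omega>' \<and> (\<exists>f'. homeomorphism \<Omega> \<Omega>' f f') \<and>
     sense_preserving_injection \<Omega> f \<and> W12_loc \<Omega> f \<and>
     (AE z in lebesgue. z \<in> \<Omega> \<longrightarrow>
        f differentiable (at z) \<and> (norm_D f z)\<^sup>2 \<le> K * \<bar>jacobian f z\<bar>)"

definition S_H2_qc :: "real \<Rightarrow> complex set \<Rightarrow> (complex \<Rightarrow> complex) set" where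
  "S_H2_qc K G = {f \<in> S_H2. quasiconformal K (ball 0 1) G f}"


definition path_length :: "(real \<Rightarrow> complex) \<Rightarrow> ennreal" where
  "path_length p =
     (SUP (n, t) \<in> {(n :: nat, t :: nat \<Rightarrow> real). mono_on {..n} t \<and> t ` {..n} \<subseteq> {0..1}}.
        \<Sum>i<n. ennreal (dist (p (t i)) (p (t (Suc i)))))"

text \<open>For injective \<open>f\<close> and distinct \<open>w\<^sub>1\<close>, \<open>w\<^sub>2\<close> on \<open>f(\<partial>\<bbbD>\<^sub>r)\<close>, the curves below run through
  exactly the two subarcs between \<open>w\<^sub>1\<close> and \<open>w\<^sub>2\<close> (counterclockwise if \<open>a < b\<close>, clockwise
  if \<open>b < a\<close>), so the infimum is the length of the shorter one.\<close>

definition shorter_subarc_length ::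
    "(complex \<Rightarrow> complex) \<Rightarrow> real \<Rightarrow> complex \<Rightarrow> complex \<Rightarrow> ennreal" where
  "shorter_subarc_length f r w1 w2 =
     (INF (a, b) \<in> {(a, b). \<bar>b - a\<bar> < 2 * pi \<and>
                       pathstart (f \<circ> part_circlepath 0 r a b) = w1 \<and>
                       pathfinish (f \<circ> part_circlepath 0 r a b) = w2}.
        path_length (f \<circ> part_circlepath 0 r a b))"

definition interior_diam_dist :: "complex set \<Rightarrow> complex \<Rightarrow> complex \<Rightarrow> ennreal" where
  "interior_diam_dist G w1 w2 =
     (INF p \<in> {p. arc p \<and> pathstart p = w1 \<and> pathfinish p = w2 \<and> p ` {0<..<1} \<subseteq> G}.
        ennreal (diameter (path_image p)))"

definition pommerenke_interior_domain :: "(complex \<Rightarrow> complex) \<Rightarrow> complex set \<Rightarrow> bool" where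
  "pommerenke_interior_domain f G \<longleftrightarrow>
     f \<in> S_H \<and> (\<exists>K\<ge>1. quasiconformal K (ball 0 1) G f) \<and>
     (SUP r\<in>{0<..<1}. SUP w1\<in>f ` sphere 0 r. SUP w2\<in>f ` sphere 0 r - {w1}.
        shorter_subarc_length f r w1 w2 / interior_diam_dist (f ` ball 0 r) w1 w2) < \<infinity>"

definition bounded_pommerenke_interior_domain ::
    "(complex \<Rightarrow> complex) \<Rightarrow> complex set \<Rightarrow> bool" where
  "bounded_pommerenke_interior_domain f G \<longleftrightarrow> pommerenke_interior_domain f G \<and> bounded G"

end

theory Submission
  imports Defs "HOL-Real_Asymp.Real_Asymp"
begin

text \<open>
  Write \<open>\<lambda> = \<parallel>D\<^sub>f\<parallel>\<close> and let \<open>z = \<rho> e\<^sup>i\<^sup>\<alpha>\<close>. Going from \<open>|w| = r\<close> in to \<open>|w| = \<rho>\<close> along a radius, across, and out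
  again joins two points of the circle whose arguments are within \<open>\<pi> (1 - \<rho>)\<close> of \<open>\<alpha>\<close>. By the growth hypothesis
  the image of this path has diameter \<open>O((1 - \<rho>) \<lambda>(z))\<close>. The Pommerenke condition turns this into a bound for the
  shorter boundary arc, and quasiconformality bounds the integral of \<open>\<lambda>\<close> by length:
  \<open>\<integral> \<lambda>(r e\<^sup>i\<^sup>\<theta>) d\<theta> = O((1 - \<rho>) \<lambda>(z))\<close> over \<open>|\<theta> - \<alpha>| \<le> \<pi> (1 - \<rho>)\<close>, uniformly in \<open>r > \<rho>\<close>.
  The strict bound by 4 in the definition of \<open>S\<^sub>H\<^sub>2\<close> says that \<open>\<lambda>\<close> decays towards the boundary no faster
  than a power of \<open>1 - \<rho>\<close> with exponent less than 1. Hence the contributions of the dyadic arcs around \<open>z\<close> to the Poisson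
  integral of \<open>\<lambda>(r e\<^sup>i\<^sup>\<theta>)\<close> form a convergent geometric series, and Fatou's lemma lets \<open>r\<close> tend to 1.

  The last step needs the radial limits of \<open>\<lambda>\<close> to exist almost everywhere. This follows from Fatou's theorem on
  radial limits, applied to the \<open>H\<^sup>2\<close> functions \<open>\<surd>h'\<close> and \<open>g' / h'\<close>. In its proof the radial
  maximal function is of weak type by the same dyadic estimate and Vitali's covering lemma, and Taylor
  polynomials approximate in \<open>H\<^sup>2\<close>.
\<close>

section \<open>Poisson integrals and dyadic arcs\<close>

lemma Jordan_sin_ge:
  assumes "0 \<le> x" "x \<le> pi / 2"
  shows "2 / pi * x \<le> sin x"
proof -
  have "concave_on {0..pi} sin"
    by (rule f''_le0_imp_concave[where f' = cos and f'' = "\<lambda>x. - sin x"])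
       (auto intro!: derivative_eq_intros sin_ge_zero)
  from concave_onD[OF this, of "2 / pi * x" 0 "pi / 2"] assms show ?thesis
    by (auto simp: field_simps)
qed

lemma norm_cis_minus_one_ge:
  assumes "\<bar>t\<bar> \<le> pi"
  shows "2 * \<bar>t\<bar> / pi \<le> norm (cis t - 1)"
proof -
  have "norm (cis t - 1) = 2 * \<bar>sin (t / 2)\<bar>"
    using dist_exp_i_1[of t] by (simp add: cis_conv_exp)
  also have "\<bar>sin (t / 2)\<bar> = sin (\<bar>t\<bar> / 2)"
    using assms sin_ge_zero[of "\<bar>t\<bar> / 2"] by (cases "t \<ge> 0") auto
  finally show ?thesis
    using Jordan_sin_ge[of "\<bar>t\<bar> / 2"] assms by (simp add: field_simps)
qed

text \<open>Moving the inner point radially to the circle costs \<open>1 - \<rho>\<close>, which is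
  itself at most the distance in question. The chord is therefore at most twice that distance, and
  this factor uses up the 2 in \<open>norm_cis_minus_one_ge\<close>.\<close>

lemma norm_cis_diff_ge:
  assumes "\<bar>t - \<alpha>\<bar> \<le> pi" "0 \<le> \<rho>" "\<rho> \<le> 1"
  shows "\<bar>t - \<alpha>\<bar> / pi \<le> norm (cis t - of_real \<rho> * cis \<alpha>)"
proof -
  have "cis t - of_real \<rho> * cis \<alpha> = cis \<alpha> * (cis (t - \<alpha>) - of_real \<rho>)"
    by (simp add: algebra_simps cis_mult)
  then have eq: "norm (cis t - of_real \<rho> * cis \<alpha>) = norm (cis (t - \<alpha>) - of_real \<rho>)"
    by (simp add: norm_mult)
  have "norm (cis (t - \<alpha>) - 1) \<le> norm (cis (t - \<alpha>) - of_real \<rho>) + norm (of_real \<rho> - 1 :: complex)"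
    using norm_triangle_ineq[of "cis (t - \<alpha>) - of_real \<rho>" "of_real \<rho> - 1"] by simp
  also have "norm (of_real \<rho> - 1 :: complex) = 1 - \<rho>"
    using assms(3) by (metis abs_of_nonneg diff_ge_0_iff_ge norm_minus_commute norm_of_real of_real_1 of_real_diff)
  also have "1 - \<rho> \<le> norm (cis (t - \<alpha>) - of_real \<rho>)"
    using norm_triangle_ineq2[of "cis (t - \<alpha>)" "of_real \<rho>"] assms by simp
  finally have "2 * \<bar>t - \<alpha>\<bar> / pi \<le> 2 * norm (cis (t - \<alpha>) - of_real \<rho>)"
    using norm_cis_minus_one_ge[OF assms(1)] by simp
  then show ?thesis
    unfolding eq by simp
qed

definition poisson_kernel :: "complex \<Rightarrow> real \<Rightarrow> real" where
  "poisson_kernel z t = (1 - (norm z)\<^sup>2) / (norm (cis t - z))\<^sup>2"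

lemma poisson_kernel_nonneg: "norm z \<le> 1 \<Longrightarrow> 0 \<le> poisson_kernel z t"
  by (simp add: poisson_kernel_def power_le_one)

lemma cis_neq_of_norm_less_one: "norm z < 1 \<Longrightarrow> cis t - z \<noteq> 0"
  by (metis eq_iff_diff_eq_0 norm_cis order_less_irrefl)

lemma continuous_on_poisson_kernel [continuous_intros]:
  assumes "norm z < 1"
  shows "continuous_on S (poisson_kernel z)"
  unfolding poisson_kernel_def
  using cis_neq_of_norm_less_one[OF assms] by (auto intro!: continuous_intros)

text \<open>The first bound serves the innermost arc. The second serves a dyadic shell:
  \<open>pi * y\<close> is the half-length of the outer arc, and the points of the shell keep at
  least half that angular distance from the centre.\<close>

lemma poisson_kernel_le:
  assumes "0 \<le> \<rho>" "\<rho> < 1"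
  shows "poisson_kernel (of_real \<rho> * cis \<alpha>) t \<le> 2 / (1 - \<rho>)"
    and "\<bar>t - \<alpha>\<bar> \<le> pi \<Longrightarrow> 0 < y \<Longrightarrow> pi * y \<le> 2 * \<bar>t - \<alpha>\<bar> \<Longrightarrow>
      poisson_kernel (of_real \<rho> * cis \<alpha>) t \<le> 8 * (1 - \<rho>) / y\<^sup>2"
proof -
  let ?n = "norm (cis t - of_real \<rho> * cis \<alpha>)"
  have num: "1 - (norm (of_real \<rho> * cis \<alpha>))\<^sup>2 = (1 - \<rho>) * (1 + \<rho>)"
    using assms by (simp add: norm_mult power2_eq_square algebra_simps)
  have "1 - \<rho> \<le> ?n"
    using norm_triangle_ineq2[of "cis t" "of_real \<rho> * cis \<alpha>"] assms by (simp add: norm_mult)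
  then have "(1 - \<rho>)\<^sup>2 \<le> ?n\<^sup>2"
    using assms by (intro power_mono) auto
  then have "(1 - \<rho>) * (1 + \<rho>) / ?n\<^sup>2 \<le> (1 - \<rho>) * (1 + \<rho>) / (1 - \<rho>)\<^sup>2"
    using assms by (intro divide_left_mono) (auto intro!: mult_pos_pos zero_less_power)
  also have "\<dots> \<le> (1 - \<rho>) * 2 / (1 - \<rho>)\<^sup>2"
    using assms by (intro divide_right_mono mult_left_mono) auto
  also have "\<dots> = 2 / (1 - \<rho>)"
    using assms by (simp add: power2_eq_square divide_simps)
  finally show "poisson_kernel (of_real \<rho> * cis \<alpha>) t \<le> 2 / (1 - \<rho>)"
    by (simp add: poisson_kernel_def num)
  assume *: "\<bar>t - \<alpha>\<bar> \<le> pi" "0 < y" "pi * y \<le> 2 * \<bar>t - \<alpha>\<bar>"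
  have "y / 2 \<le> \<bar>t - \<alpha>\<bar> / pi"
    using *(3) by (simp add: field_simps)
  also have "\<dots> \<le> ?n"
    using norm_cis_diff_ge[of t \<alpha> \<rho>] * assms by simp
  finally have "(y / 2)\<^sup>2 \<le> ?n\<^sup>2"
    using *(2) by (intro power_mono) auto
  then have "(1 - \<rho>) * (1 + \<rho>) / ?n\<^sup>2 \<le> (1 - \<rho>) * (1 + \<rho>) / (y / 2)\<^sup>2"
    using assms *(2) by (intro divide_left_mono mult_pos_pos zero_less_power) auto
  also have "\<dots> \<le> (1 - \<rho>) * 2 / (y / 2)\<^sup>2"
    using assms by (intro divide_right_mono mult_left_mono) auto
  also have "\<dots> = 8 * (1 - \<rho>) / y\<^sup>2"
    by (simp add: power2_eq_square)
  finally show "poisson_kernel (of_real \<rho> * cis \<alpha>) t \<le> 8 * (1 - \<rho>) / y\<^sup>2"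
    by (simp add: poisson_kernel_def num)
qed

text \<open>On the shell of scale \<open>x\<close> the kernel is
  \<open>O((1 - \<rho>) / x^2)\<close>, so the shell contributes \<open>O(A)\<close> times the power
  \<open>b - 1\<close> of \<open>x / (1 - \<rho>)\<close>. As \<open>b < 1\<close>, the sum over
  dyadic scales is dominated by a geometric series. The lemma serves the maximal function with
  \<open>b = 0\<close> and \<open>norm_D\<close> with \<open>b = q / 2 - 1\<close>.\<close>

lemma poisson_integral_le_of_interval_growth:
  fixes \<phi> :: "real \<Rightarrow> real"
  assumes \<rho>: "0 \<le> \<rho>" "\<rho> < 1" and b: "b < 1"
    and cont: "continuous_on {\<alpha> - pi..\<alpha> + pi} \<phi>" and nonneg: "\<And>t. 0 \<le> \<phi> t"
    and bound: "\<And>x. 1 - \<rho> \<le> x \<Longrightarrow> x \<le> 1 \<Longrightarrow>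
      integral {\<alpha> - pi * x..\<alpha> + pi * x} \<phi> \<le> A * x * (x / (1 - \<rho>)) powr b"
  shows "integral {\<alpha> - pi..\<alpha> + pi} (\<lambda>t. \<phi> t * poisson_kernel (of_real \<rho> * cis \<alpha>) t)
    \<le> 8 * 2 powr (1 - b) / (1 - 2 powr (b - 1)) * A"
proof -
  define s where "s = 1 - \<rho>"
  \<comment> \<open>The cap at 1 makes the last arc exactly one period long.\<close>
  define \<sigma> where "\<sigma> k = min (2 ^ k * s) 1" for k :: nat
  define J where "J k = {\<alpha> - pi * \<sigma> k..\<alpha> + pi * \<sigma> k}" for k
  let ?P = "poisson_kernel (of_real \<rho> * cis \<alpha>)"
  let ?I = "{\<alpha> - pi..\<alpha> + pi}"
  have s: "0 < s" "s \<le> 1" using \<rho> by (auto simp: s_def)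
  have s_le: "s \<le> 2 ^ k * s" for k
    using s by simp
  have \<sigma>: "s \<le> \<sigma> k" "\<sigma> k \<le> 1" "0 < \<sigma> k" for k
    using s s_le[of k] by (auto simp: \<sigma>_def)
  obtain n where n: "1 / s < 2 ^ n"
    using real_arch_pow[of 2] by auto
  have \<sigma>n: "\<sigma> n = 1"
    using n s by (simp add: \<sigma>_def field_simps)
  \<comment> \<open>Stopping at the first capped scale means that the cap loses at most a factor 2,
    which is what \<open>\<sigma>_ge\<close> records.\<close>
  define N where "N = (LEAST n. \<sigma> n = 1)"
  have N: "\<sigma> N = 1" unfolding N_def using \<sigma>n by (rule LeastI)
  have \<sigma>_ge: "2 ^ k / 2 * s \<le> \<sigma> k" if "k \<le> N" for k
  proof (cases k)
    case (Suc j)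
    have "\<sigma> j \<noteq> 1" using not_less_Least[of j "\<lambda>n. \<sigma> n = 1"] that Suc by (simp add: N_def)
    then have "2 ^ j * s < 1" by (auto simp: \<sigma>_def min_def split: if_splits)
    then show ?thesis using Suc s by (auto simp: \<sigma>_def)
  qed (use s \<sigma>(1)[of 0] in auto)
  have J_sub: "J k \<subseteq> ?I" for k
    using \<sigma>[of k] by (auto simp: J_def intro: order_trans)
  have int: "(\<lambda>t. \<phi> t * ?P t) integrable_on ?I"
    using \<rho> cont by (intro integrable_continuous_real continuous_intros) (auto simp: norm_mult)
  have intJ: "\<phi> integrable_on J k" for k
    using continuous_on_subset[OF cont J_sub] unfolding J_def by (rule integrable_continuous_real)
  have int_ind: "(\<lambda>t. if t \<in> J k then \<phi> t else 0) integrable_on ?I" for k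
    using integrable_restrict_Int[of "J k" \<phi> ?I] intJ[of k] J_sub[of k] by (simp add: Int_absorb2)
  have pointwise: "\<phi> t * ?P t \<le> (\<Sum>k\<le>N. 8 * s / (\<sigma> k)\<^sup>2 * (if t \<in> J k then \<phi> t else 0))"
    if t: "t \<in> ?I" for t
  proof -
    have tJ: "t \<in> J k \<longleftrightarrow> \<bar>t - \<alpha>\<bar> \<le> pi * \<sigma> k" for k by (auto simp: J_def)
    have JN: "t \<in> J N" using t N by (auto simp: J_def)
    \<comment> \<open>For the smallest arc containing \<open>t\<close>, either \<open>k = 0\<close>
      or \<open>t\<close> lies outside the preceding arc, so one of the two kernel bounds applies
      and a single term of the sum suffices.\<close>
    define k where "k = (LEAST k. t \<in> J k)"
    have k: "t \<in> J k" "k \<le> N"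
      unfolding k_def using JN by (auto intro: LeastI Least_le)
    have "?P t \<le> 8 * s / (\<sigma> k)\<^sup>2"
    proof (cases k)
      case 0
      have "?P t \<le> 2 / s" using poisson_kernel_le(1)[OF \<rho>] by (simp add: s_def)
      also have "\<dots> \<le> 8 * s / s\<^sup>2" using s by (simp add: power2_eq_square field_simps)
      finally show ?thesis using 0 s by (simp add: \<sigma>_def)
    next
      case (Suc j)
      have "t \<notin> J j" using not_less_Least[of j "\<lambda>k. t \<in> J k"] Suc by (simp add: k_def)
      then have "pi * \<sigma> j < \<bar>t - \<alpha>\<bar>" by (simp add: tJ)
      moreover have "\<sigma> k \<le> 2 * \<sigma> j" using Suc s by (auto simp: \<sigma>_def)
      then have "pi * \<sigma> k \<le> pi * (2 * \<sigma> j)"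
        by (intro mult_left_mono) auto
      then have "pi * \<sigma> k \<le> 2 * (pi * \<sigma> j)"
        by (simp only: mult.left_commute)
      moreover have "2 * (pi * \<sigma> j) \<le> 2 * \<bar>t - \<alpha>\<bar>"
        using calculation(1) by (intro mult_left_mono less_imp_le) auto
      ultimately have "pi * \<sigma> k \<le> 2 * \<bar>t - \<alpha>\<bar>"
        by (blast intro: order_trans)
      then show ?thesis using poisson_kernel_le(2)[OF \<rho>, of t \<alpha> "\<sigma> k"] t \<sigma>[of k]
        by (auto simp: s_def)
    qed
    from mult_right_mono[OF this nonneg[of t]]
    have "\<phi> t * ?P t \<le> 8 * s / (\<sigma> k)\<^sup>2 * (if t \<in> J k then \<phi> t else 0)"
      using k by (simp add: mult.commute)
    also have "\<dots> \<le> (\<Sum>k\<le>N. 8 * s / (\<sigma> k)\<^sup>2 * (if t \<in> J k then \<phi> t else 0))"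
      using k s nonneg by (intro member_le_sum) auto
    finally show ?thesis .
  qed
  \<comment> \<open>The sign of \<open>A\<close> is forced by the growth bound at
    \<open>x = 1\<close>, because the integral there is nonnegative.\<close>
  have A: "0 \<le> A"
  proof -
    have "0 \<le> integral {\<alpha> - pi * 1..\<alpha> + pi * 1} \<phi>"
      by (intro integral_nonneg integrable_continuous_real) (use cont nonneg in auto)
    then have "0 \<le> A * (1 / s) powr b" using bound[of 1] \<rho> by (auto simp: s_def)
    moreover have "0 < (1 / s) powr b" using s by simp
    ultimately show ?thesis by (simp add: zero_le_mult_iff)
  qed
  define c where "c = 2 powr (b - 1)"
  have c: "0 < c" "c < 1" using b by (auto simp: c_def powr_less_one)
  have summand_le: "8 * s / (\<sigma> k)\<^sup>2 * integral (J k) \<phi> \<le> 8 * 2 powr (1 - b) * A * c ^ k" if "k \<le> N" for k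
  proof -
    have "integral (J k) \<phi> \<le> A * \<sigma> k * (\<sigma> k / s) powr b"
      unfolding J_def s_def using bound[of "\<sigma> k"] \<sigma>[of k] by (simp add: s_def)
    then have "8 * s / (\<sigma> k)\<^sup>2 * integral (J k) \<phi> \<le> 8 * s / (\<sigma> k)\<^sup>2 * (A * \<sigma> k * (\<sigma> k / s) powr b)"
      using s by (intro mult_left_mono) auto
    also have "\<dots> = 8 * A * (\<sigma> k / s) powr (b - 1)"
      using s \<sigma>[of k] by (simp add: powr_diff power2_eq_square field_simps)
    \<comment> \<open>The exponent \<open>b - 1\<close> is negative, so the lower bound for
      \<open>\<sigma> k\<close> becomes an upper bound.\<close>
    also have "\<dots> \<le> 8 * A * (2 ^ k / 2) powr (b - 1)"
      using A b s \<sigma>_ge[OF that] by (intro mult_left_mono powr_mono2') (auto simp: field_simps)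
    also have "(2 ^ k / 2) powr (b - 1) = 2 powr (1 - b) * c ^ k"
      by (simp add: c_def powr_divide powr_diff flip: powr_realpow)
         (simp add: powr_powr powr_diff mult.commute powr_minus field_simps flip: powr_add)
    finally show ?thesis by (simp only: mult_ac)
  qed
  have "integral ?I (\<lambda>t. \<phi> t * ?P t)
      \<le> integral ?I (\<lambda>t. \<Sum>k\<le>N. 8 * s / (\<sigma> k)\<^sup>2 * (if t \<in> J k then \<phi> t else 0))"
    using pointwise int int_ind by (intro integral_le integrable_sum integrable_on_mult_right) auto
  also have "\<dots> = (\<Sum>k\<le>N. integral ?I (\<lambda>t. 8 * s / (\<sigma> k)\<^sup>2 * (if t \<in> J k then \<phi> t else 0)))"
    by (intro integral_sum finite_atMost integrable_on_mult_right int_ind)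
  also have "\<dots> = (\<Sum>k\<le>N. 8 * s / (\<sigma> k)\<^sup>2 * integral (J k) \<phi>)"
    using integral_restrict_Int[of ?I "J _" \<phi>] J_sub by (simp add: Int_absorb2)
  also have "\<dots> \<le> (\<Sum>k\<le>N. 8 * 2 powr (1 - b) * A * c ^ k)"
    using summand_le by (intro sum_mono) auto
  also have "\<dots> = 8 * 2 powr (1 - b) * A * (\<Sum>k\<le>N. c ^ k)"
    by (simp add: sum_distrib_left)
  also have "\<dots> \<le> 8 * 2 powr (1 - b) * A * (1 / (1 - c))"
  proof (intro mult_left_mono)
    have "(\<Sum>k\<le>N. c ^ k) \<le> (\<Sum>k. c ^ k)"
      using c by (intro sum_le_suminf summable_geometric) auto
    then show "(\<Sum>k\<le>N. c ^ k) \<le> 1 / (1 - c)" using c by (simp add: suminf_geometric)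
  qed (use A in auto)
  finally show ?thesis by (simp add: c_def field_simps)
qed

text \<open>Vitali's covering lemma selects disjoint intervals whose fivefold enlargements still
  cover \<open>S\<close>. An enlarged interval has length \<open>10 * r t\<close>, at most
  \<open>10 / y\<close> times the integral of \<open>\<phi>\<close> over the original one, and by
  disjointness these integrals add up to at most the whole.\<close>

lemma Hardy_Littlewood_weak_type:
  fixes \<phi> :: "real \<Rightarrow> real"
  assumes cont: "continuous_on {c..d} \<phi>" and nonneg: "\<And>t. 0 \<le> \<phi> t"
    and y: "0 < y" and S: "S \<in> sets lebesgue"
    and large: "\<And>t. t \<in> S \<Longrightarrow> \<exists>x>0. {t - x..t + x} \<subseteq> {c..d} \<and> y * x \<le> integral {t - x..t + x} \<phi>"
  shows "emeasure lebesgue S \<le> ennreal (10 / y * integral {c..d} \<phi>)"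
proof -
  from large obtain r where r: "\<And>t. t \<in> S \<Longrightarrow> 0 < r t"
      "\<And>t. t \<in> S \<Longrightarrow> {t - r t..t + r t} \<subseteq> {c..d}"
      "\<And>t. t \<in> S \<Longrightarrow> y * r t \<le> integral {t - r t..t + r t} \<phi>"
    by metis
  have bd: "0 < r t \<and> r t \<le> d - c" if "t \<in> S" for t
    using r(1,2)[OF that] by simp
  have "S \<subseteq> (\<Union>i\<in>S. cball (id i) (r i))"
    using r(1) by force
  from Vitali_covering_lemma_cballs[OF this bd]
  obtain C where C: "countable C" "C \<subseteq> S"
    and disj: "pairwise (\<lambda>i j. disjnt (cball (id i) (r i)) (cball (id j) (r j))) C"
    and cov: "S \<subseteq> (\<Union>i\<in>C. cball (id i) (5 * r i))"
    by auto
  define J where "J t = {t - r t..t + r t}" for t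
  \<comment> \<open>Finite subfamilies come first; the bound does not depend on the subfamily, so it
    passes to the countable union.\<close>
  have fin: "measure lebesgue (\<Union>i\<in>I. cball (id i) (5 * r i)) \<le> 10 / y * integral {c..d} \<phi>"
    if I: "I \<subseteq> C" "finite I" for I
  proof -
    have IS: "I \<subseteq> S" using I C by auto
    have Jsub: "i \<in> I \<Longrightarrow> J i \<subseteq> {c..d}" for i using r(2) IS by (auto simp: J_def)
    have intJ: "\<phi> integrable_on J i" if "i \<in> I" for i
      unfolding J_def using continuous_on_subset[OF cont Jsub[OF that]]
      by (intro integrable_continuous_real) (simp add: J_def)
    have int_ind: "(\<lambda>t. if t \<in> J i then \<phi> t else 0) integrable_on {c..d}" if "i \<in> I" for i
      using integrable_restrict_Int[of "J i" \<phi> "{c..d}"] intJ[OF that] Jsub[OF that]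
      by (simp add: Int_absorb2)
    have "measure lebesgue (\<Union>i\<in>I. cball (id i) (5 * r i))
        \<le> (\<Sum>i\<in>I. measure lebesgue (cball (id i) (5 * r i)))"
      by (rule measure_UNION_le) (use I in auto)
    also have "\<dots> = (\<Sum>i\<in>I. 10 * r i)"
      using r(1) IS by (intro sum.cong) (auto simp: cball_eq_atLeastAtMost less_imp_le subset_iff)
    also have "\<dots> \<le> (\<Sum>i\<in>I. 10 / y * integral (J i) \<phi>)"
      using r(3) IS y by (intro sum_mono) (auto simp: J_def field_simps)
    also have "\<dots> = 10 / y * (\<Sum>i\<in>I. integral (J i) \<phi>)"
      by (simp add: sum_distrib_left)
    also have "(\<Sum>i\<in>I. integral (J i) \<phi>)
        = integral {c..d} (\<lambda>t. \<Sum>i\<in>I. if t \<in> J i then \<phi> t else 0)"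
      using Jsub int_ind I by (subst integral_sum)
        (auto intro!: sum.cong simp: integral_restrict_Int Int_absorb2)
    \<comment> \<open>The intervals are disjoint, so at each point at most one summand is
      nonzero.\<close>
    also have "\<dots> \<le> integral {c..d} \<phi>"
    proof (intro integral_le integrable_sum)
      fix t assume "t \<in> {c..d}"
      show "(\<Sum>i\<in>I. if t \<in> J i then \<phi> t else 0) \<le> \<phi> t"
      proof (cases "\<exists>k\<in>I. t \<in> J k")
        case True
        then obtain k where k: "k \<in> I" "t \<in> J k" by blast
        have "t \<notin> J i" if "i \<in> I" "i \<noteq> k" for i
        proof -
          have "disjnt (cball (id i) (r i)) (cball (id k) (r k))"
            using pairwiseD[OF disj, of i k] that k(1) I(1) by blast
          then show ?thesis
            using k(2) by (auto simp: J_def cball_eq_atLeastAtMost disjnt_def)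
        qed
        then have "(\<Sum>i\<in>I. if t \<in> J i then \<phi> t else 0) = (\<Sum>i\<in>I. if i = k then \<phi> t else 0)"
          using k by (intro sum.cong) auto
        then show ?thesis using k I by simp
      next
        case False
        then have "(\<Sum>i\<in>I. if t \<in> J i then \<phi> t else 0) = 0"
          by (intro sum.neutral) auto
        then show ?thesis using nonneg by simp
      qed
    qed (use int_ind I cont integrable_continuous_real in auto)
    finally show ?thesis using y by (simp add: divide_right_mono)
  qed
  have U: "(\<Union>i\<in>C. cball (id i) (5 * r i)) \<in> fmeasurable lebesgue"
    by (rule fmeasurable_UN_bound[OF C(1) _ fin]) auto
  have "emeasure lebesgue S \<le> emeasure lebesgue (\<Union>i\<in>C. cball (id i) (5 * r i))"
    using cov U by (intro emeasure_mono) (auto dest: fmeasurableD)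
  also have "\<dots> = ennreal (measure lebesgue (\<Union>i\<in>C. cball (id i) (5 * r i)))"
    using U by (simp add: emeasure_eq_measure2)
  also have "\<dots> \<le> ennreal (10 / y * integral {c..d} \<phi>)"
    by (intro ennreal_leI measure_UN_bound[OF C(1) _ fin]) auto
  finally show ?thesis .
qed

section \<open>Periodic integrals, Poisson majorants and orthogonality of exponentials\<close>

lemma cis_add_2pi_int: "cis (t + 2 * pi * of_int k) = cis t"
  by (metis add.commute cis_mult cis_multiple_2pi Ints_of_int mult.commute mult_1 mult.assoc)

lemma integral_periodic_shift:
  fixes \<phi> :: "real \<Rightarrow> 'a::real_normed_vector"
  assumes "\<And>t. \<phi> (t + 2 * pi) = \<phi> t"
  shows "integral {a + 2 * pi * of_int k..b + 2 * pi * of_int k} \<phi> = integral {a..b} \<phi>"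
proof -
  interpret periodic_fun_simple \<phi> "2 * pi" by standard (rule assms)
  have "\<phi> = (\<lambda>t. \<phi> (t + - (2 * pi * of_int k)))"
    using plus_of_int[of _ "- k"] by (auto simp: algebra_simps)
  then show ?thesis
    using integral_shift_real_ivl[of a "- (2 * pi * of_int k)" b \<phi>] by simp
qed

lemma integral_periodic:
  fixes \<phi> :: "real \<Rightarrow> 'a::banach"
  assumes per: "\<And>t. \<phi> (t + 2 * pi) = \<phi> t" and cont: "continuous_on UNIV \<phi>"
  shows "integral {a..a + 2 * pi} \<phi> = integral {0..2 * pi} \<phi>"
proof -
  define k where "k = \<lfloor>a / (2 * pi)\<rfloor>"
  define b where "b = a - 2 * pi * of_int k"
  have b: "0 \<le> b" "b \<le> 2 * pi"
  proof -
    have "of_int k \<le> a / (2 * pi)" "a / (2 * pi) < of_int k + 1"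
      unfolding k_def by linarith+
    then show "0 \<le> b" "b \<le> 2 * pi"
      by (simp_all add: b_def pos_le_divide_eq pos_divide_less_eq algebra_simps)
  qed
  have int: "\<phi> integrable_on {c..d}" for c d
    using cont by (intro integrable_continuous_real) (auto intro: continuous_on_subset)
  have "integral {a..a + 2 * pi} \<phi> = integral {b..b + 2 * pi} \<phi>"
    using integral_periodic_shift[of \<phi> b k "b + 2 * pi"] per by (simp add: b_def)
  also have "\<dots> = integral {b..2 * pi} \<phi> + integral {2 * pi..b + 2 * pi} \<phi>"
    using Henstock_Kurzweil_Integration.integral_combine[of b "2 * pi" "b + 2 * pi" \<phi>] b int by auto
  also have "integral {2 * pi..b + 2 * pi} \<phi> = integral {0..b} \<phi>"
    using integral_periodic_shift[of \<phi> 0 1 b] per by simp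
  also have "integral {b..2 * pi} \<phi> + integral {0..b} \<phi> = integral {0..2 * pi} \<phi>"
    using Henstock_Kurzweil_Integration.integral_combine[of 0 b "2 * pi" \<phi>] b int by (simp add: add.commute)
  finally show ?thesis .
qed

lemma continuous_on_cis_image:
  assumes "continuous_on (ball 0 1) F" "0 \<le> r" "r < 1"
  shows "continuous_on S (\<lambda>t. F (of_real r * cis t))"
  by (rule continuous_on_compose2[OF assms(1)])
     (use assms in \<open>auto intro!: continuous_intros simp: norm_mult\<close>)

text \<open>Cauchy's formula is applied to \<open>V w (1 - |z|\<^sup>2) / (1 - cnj z w)\<close>, which agrees with \<open>V\<close>
  at \<open>z\<close> and whose Cauchy kernel has the Poisson kernel as its modulus.\<close>

lemma norm_le_poisson_integral:
  assumes holo: "V holomorphic_on ball 0 1" and cont: "continuous_on (cball 0 1) V"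
    and z: "norm z < 1"
  shows "norm (V z) \<le> 1 / (2 * pi) * integral {0..2 * pi} (\<lambda>t. norm (V (cis t)) * poisson_kernel z t)"
proof -
  define g where "g w = V w * (1 - (norm z)\<^sup>2) / (1 - cnj z * w)" for w
  have nz: "1 - cnj z * w \<noteq> 0" if "norm w \<le> 1" for w
  proof
    assume "1 - cnj z * w = 0"
    then have "norm z * norm w = 1"
      by (metis complex_mod_cnj eq_iff_diff_eq_0 norm_mult norm_one)
    moreover have "norm z * norm w \<le> norm z * 1" using that by (intro mult_left_mono) auto
    ultimately show False using z by simp
  qed
  have g_cont: "continuous_on (cball 0 1) g"
    unfolding g_def using nz by (intro continuous_intros cont) auto
  have g_holo: "g holomorphic_on ball 0 1"
    unfolding g_def using nz by (intro holomorphic_intros holo) auto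
  have gz: "g z = V z"
  proof -
    have "1 - cnj z * z = of_real (1 - (norm z)\<^sup>2)"
      using complex_norm_square[of z] by (simp add: mult.commute)
    then show ?thesis
      using nz[of z] z by (simp add: g_def)
  qed
  let ?J = "\<lambda>t. g (cis t) / (cis t - z) * \<i> * cis t"
  have "((\<lambda>u. g u / (u - z)) has_contour_integral 2 * of_real pi * \<i> * g z) (circlepath 0 1)"
    using Cauchy_integral_circlepath[OF g_cont g_holo, of z] z by simp
  then have J: "(?J has_integral 2 * of_real pi * \<i> * V z) {0..2 * pi}"
    by (simp add: circlepath_def has_contour_integral_part_circlepath_iff gz)
  have norm_J: "norm (?J t) = norm (V (cis t)) * poisson_kernel z t" for t
  proof -
    \<comment> \<open>On the unit circle the inverse is the conjugate, so the added denominator has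
      the same modulus as the Cauchy denominator. Together they give the square in the Poisson
      kernel.\<close>
    have "1 - cnj z * cis t = cis t * cnj (cis t - z)"
      by (simp add: algebra_simps cis_cnj cis_mult)
    then have "norm (1 - cnj z * cis t) = norm (cis t - z)"
      by (metis complex_mod_cnj mult_1 norm_cis norm_mult)
    moreover have "norm (1 - (complex_of_real (norm z))\<^sup>2) = 1 - (norm z)\<^sup>2"
    proof -
      have "1 - (complex_of_real (norm z))\<^sup>2 = of_real (1 - (norm z)\<^sup>2)" by simp
      then show ?thesis using z by (simp only: norm_of_real) (simp add: power_le_one)
    qed
    ultimately show ?thesis
      by (simp add: g_def norm_mult norm_divide poisson_kernel_def power2_eq_square)
  qed
  have "norm (2 * of_real pi * \<i> * V z) \<le> integral {0..2 * pi} (\<lambda>t. norm (V (cis t)) * poisson_kernel z t)"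
    unfolding integral_unique[OF J, symmetric]
  proof (rule integral_norm_bound_integral)
    show "?J integrable_on {0..2 * pi}" using J by blast
    show "(\<lambda>t. norm (V (cis t)) * poisson_kernel z t) integrable_on {0..2 * pi}"
      using z by (intro integrable_continuous_real continuous_intros
          continuous_on_compose2[OF cont]) auto
  qed (simp only: norm_J order_refl)
  then show ?thesis by (simp add: norm_mult field_simps)
qed

lemma has_integral_cis_int:
  fixes k :: int
  shows "((\<lambda>t. cis (of_int k * t)) has_integral (if k = 0 then 2 * pi else 0)) {0..2 * pi}"
proof (cases "k = 0")
  case True
  then show ?thesis using has_integral_const_real[of "1::complex" 0 "2 * pi"]
    by (simp add: scaleR_conv_of_real)
next
  case False
  have "((\<lambda>t. cis (of_int k * t)) has_integral
      (cis (of_int k * (2 * pi)) / (\<i> * of_int k) - cis (of_int k * 0) / (\<i> * of_int k))) {0..2 * pi}"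
  proof (rule fundamental_theorem_of_calculus)
    fix t :: real
    have "((\<lambda>t. cis (of_int k * t) / (\<i> * of_int k)) has_vector_derivative
        (of_int k * (\<i> * cis (of_int k * t))) / (\<i> * of_int k)) (at t within {0..2*pi})"
      by (auto intro!: derivative_eq_intros simp: has_vector_derivative_def
          scaleR_conv_of_real fun_eq_iff complex_eq_iff)
    then show "((\<lambda>t. cis (of_int k * t) / (\<i> * of_int k)) has_vector_derivative cis (of_int k * t))
        (at t within {0..2*pi})"
      using False by simp
  qed simp
  then show ?thesis using False cis_add_2pi_int[of 0 k] by (simp add: mult.commute)
qed

text \<open>Expanded as a double sum, the squared modulus keeps only its diagonal terms after
  integration.\<close>

lemma has_integral_norm_trig_poly:
  fixes c :: "nat \<Rightarrow> complex"
  shows "((\<lambda>t. (norm (\<Sum>n<M. c n * cis (of_nat n * t)))\<^sup>2) has_integral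
    2 * pi * (\<Sum>n<M. (norm (c n))\<^sup>2)) {0..2 * pi}"
proof -
  have "((\<lambda>t. \<Sum>m<M. \<Sum>n<M. c m * cnj (c n) * cis (of_int (int m - int n) * t)) has_integral
     (\<Sum>m<M. \<Sum>n<M. c m * cnj (c n) * (if int m - int n = 0 then 2 * pi else 0))) {0..2 * pi}"
    by (intro has_integral_sum has_integral_mult_right has_integral_cis_int) auto
  also have "(\<lambda>t. \<Sum>m<M. \<Sum>n<M. c m * cnj (c n) * cis (of_int (int m - int n) * t))
      = (\<lambda>t. of_real ((norm (\<Sum>n<M. c n * cis (of_nat n * t)))\<^sup>2))"
  proof
    fix t
    have "cis (of_int (int m - int n) * t) = cis (of_nat m * t) * cnj (cis (of_nat n * t))" for m n
      by (simp add: cis_cnj cis_mult left_diff_distrib)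
    then show "(\<Sum>m<M. \<Sum>n<M. c m * cnj (c n) * cis (of_int (int m - int n) * t))
        = of_real ((norm (\<Sum>n<M. c n * cis (of_nat n * t)))\<^sup>2)"
      unfolding complex_norm_square by (simp only: cnj_sum complex_cnj_mult sum_product mult_ac)
  qed
  also have "(\<Sum>m<M. \<Sum>n<M. c m * cnj (c n) * (if int m - int n = 0 then 2 * pi else 0))
      = of_real (2 * pi * (\<Sum>n<M. (norm (c n))\<^sup>2))"
  proof -
    have "(\<Sum>n<M. c m * cnj (c n) * (if int m - int n = 0 then 2 * pi else 0))
        = of_real (2 * pi * (norm (c m))\<^sup>2)" if "m < M" for m
    proof -
      have "(\<Sum>n<M. c m * cnj (c n) * (if int m - int n = 0 then 2 * pi else 0))
          = (\<Sum>n<M. if n = m then of_real (2 * pi) * (c m * cnj (c m)) else 0)"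
        by (intro sum.cong) auto
      also have "\<dots> = of_real (2 * pi) * (c m * cnj (c m))"
        using that by simp
      finally show ?thesis
        unfolding of_real_mult complex_norm_square by simp
    qed
    then show ?thesis by (simp add: sum_distrib_left)
  qed
  finally have "((\<lambda>t. complex_of_real ((norm (\<Sum>n<M. c n * cis (of_nat n * t)))\<^sup>2)) has_integral
      of_real (2 * pi * (\<Sum>n<M. (norm (c n))\<^sup>2))) {0..2 * pi}" .
  from has_integral_linear[OF this bounded_linear_Re] show ?thesis
    by (simp only: o_def Re_complex_of_real)
qed

section \<open>Radial limits of Hardy space functions\<close>

text \<open>The identity for partial sums passes to the limit by dominated convergence: on the
  circle of radius \<open>r\<close> the series converges absolutely, which supplies a constant
  majorant.\<close>

lemma power_series_Parseval:
  assumes sums: "\<And>z. norm z < 1 \<Longrightarrow> (\<lambda>n. a n * z ^ n) sums F z" and r: "0 \<le> r" "r < 1"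
  shows "(\<lambda>n. (norm (a n))\<^sup>2 * r ^ (2 * n)) sums
    (1 / (2 * pi) * integral {0..2 * pi} (\<lambda>t. (norm (F (of_real r * cis t)))\<^sup>2))"
proof -
  define c where "c n = a n * of_real r ^ n" for n
  let ?S = "\<lambda>M t. \<Sum>n<M. c n * cis (of_nat n * t)"
  have summ: "summable (\<lambda>n. norm (c n))"
  proof -
    \<comment> \<open>Convergence at a point \<open>q\<close> between \<open>r\<close> and 1 gives
      absolute convergence at \<open>r\<close>.\<close>
    obtain q where q: "r < q" "q < 1" using r dense by blast
    have "summable (\<lambda>n. a n * of_real q ^ n)"
      using sums[of "of_real q"] q r by (auto simp: sums_iff)
    from powser_insidea[OF this, of "of_real r"] show ?thesis
      using q r by (simp add: c_def)
  qed
  have cn: "c n * cis (of_nat n * t) = a n * (of_real r * cis t) ^ n" for n t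
    by (simp add: c_def power_mult_distrib Complex.DeMoivre)
  have lim: "(\<lambda>M. ?S M t) \<longlonglongrightarrow> F (of_real r * cis t)" for t
    using sums[of "of_real r * cis t"] r by (simp add: sums_def cn norm_mult)
  have S_le: "norm (?S M t) \<le> (\<Sum>n. norm (c n))" for M t
  proof -
    have "norm (?S M t) \<le> (\<Sum>n<M. norm (c n))"
      by (rule sum_norm_le) (simp add: norm_mult)
    also have "\<dots> \<le> (\<Sum>n. norm (c n))"
      using summ by (intro sum_le_suminf) auto
    finally show ?thesis .
  qed
  have "(\<lambda>M. integral {0..2 * pi} (\<lambda>t. (norm (?S M t))\<^sup>2))
      \<longlonglongrightarrow> integral {0..2 * pi} (\<lambda>t. (norm (F (of_real r * cis t)))\<^sup>2)"
  proof (rule dominated_convergence(2))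
    show "(\<lambda>t. (norm (?S M t))\<^sup>2) integrable_on {0..2 * pi}" for M
      using has_integral_norm_trig_poly by blast
    show "(\<lambda>t. (\<Sum>n. norm (c n))\<^sup>2) integrable_on {0..2 * pi}" by (rule integrable_const_ivl)
    show "norm ((norm (?S M t))\<^sup>2) \<le> (\<Sum>n. norm (c n))\<^sup>2" for M t
      using S_le[of t M] by (simp add: power_mono)
  qed (intro tendsto_intros lim)
  then have "(\<lambda>M. 2 * pi * (\<Sum>n<M. (norm (c n))\<^sup>2))
      \<longlonglongrightarrow> integral {0..2 * pi} (\<lambda>t. (norm (F (of_real r * cis t)))\<^sup>2)"
    by (simp only: integral_unique[OF has_integral_norm_trig_poly])
  then have "(\<lambda>M. 1 / (2 * pi) * (2 * pi * (\<Sum>n<M. (norm (c n))\<^sup>2)))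
      \<longlonglongrightarrow> 1 / (2 * pi) * integral {0..2 * pi} (\<lambda>t. (norm (F (of_real r * cis t)))\<^sup>2)"
    by (intro tendsto_mult_left)
  moreover have "(norm (c n))\<^sup>2 = (norm (a n))\<^sup>2 * r ^ (2 * n)" for n
    using r by (simp add: c_def norm_mult norm_power power_mult_distrib power_mult power2_commute
        flip: power_mult) (simp add: mult.commute)
  ultimately show ?thesis by (simp add: sums_def)
qed

text \<open>For each fixed radius the condition on \<open>t\<close> is open, and a union of open
  sets over uncountably many radii is still open.\<close>

lemma radial_superlevel_measurable:
  assumes W: "continuous_on (ball 0 1) W" and R: "R \<le> 1"
  shows "{t \<in> {0..2 * pi}. \<exists>r\<ge>0. r < R \<and> y < (norm (W (of_real r * cis t)))\<^sup>2} \<in> sets lebesgue"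
proof -
  have "open {t. y < (norm (W (of_real r * cis t)))\<^sup>2}" if "0 \<le> r" "r < R" for r
    using continuous_on_cis_image[OF W, of r UNIV] that R
    by (intro open_Collect_less continuous_intros) auto
  then have "open (\<Union>r\<in>{0..<R}. {t. y < (norm (W (of_real r * cis t)))\<^sup>2})"
    by (intro open_UN) auto
  then have "{0..2 * pi} \<inter> (\<Union>r\<in>{0..<R}. {t. y < (norm (W (of_real r * cis t)))\<^sup>2}) \<in> sets lebesgue"
    by (intro sets.Int) auto
  also have "{0..2 * pi} \<inter> (\<Union>r\<in>{0..<R}. {t. y < (norm (W (of_real r * cis t)))\<^sup>2})
      = {t \<in> {0..2 * pi}. \<exists>r\<ge>0. r < R \<and> y < (norm (W (of_real r * cis t)))\<^sup>2}"
    by auto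
  finally show ?thesis .
qed

text \<open>The square of \<open>W\<close> is holomorphic, so its modulus at an inner point is at
  most the Poisson integral of its modulus on the circle of radius \<open>R\<close>. If all centred
  interval averages were small, the dyadic estimate would contradict this; hence the covering lemma
  applies to the superlevel set. The constant 320 is 10 from the covering, 16 from the dyadic
  estimate and 2 from the two periods in \<open>{- pi..3 * pi}\<close>.\<close>

lemma radial_maximal_weak_type_aux:
  assumes W: "W holomorphic_on ball 0 1" and R: "0 < R" "R < 1" and y: "0 < y"
  shows "emeasure lebesgue {t \<in> {0..2 * pi}. \<exists>r\<ge>0. r < R \<and> y < (norm (W (of_real r * cis t)))\<^sup>2}
    \<le> ennreal (320 / y * integral {0..2 * pi} (\<lambda>t. (norm (W (of_real R * cis t)))\<^sup>2))"
proof -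
  \<comment> \<open>The dilation by \<open>R < 1\<close> makes \<open>V\<close> continuous on the
    closed disk, as \<open>norm_le_poisson_integral\<close> requires.\<close>
  define V where "V z = (W (of_real R * z))\<^sup>2" for z
  define \<phi> where "\<phi> t = (norm (W (of_real R * cis t)))\<^sup>2" for t
  let ?S = "{t \<in> {0..2 * pi}. \<exists>r\<ge>0. r < R \<and> y < (norm (W (of_real r * cis t)))\<^sup>2}"
  note W_cont = holomorphic_on_imp_continuous_on[OF W]
  have Rz: "of_real R * z \<in> ball (0::complex) 1" if "norm z \<le> 1" for z
    using le_less_trans[OF mult_left_le[OF that, of R] R(2)] R by (simp add: norm_mult)
  have V_cont: "continuous_on (cball 0 1) V"
    unfolding V_def by (intro continuous_intros continuous_on_compose2[OF W_cont]) (use Rz in auto)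
  have V_holo: "V holomorphic_on ball 0 1"
  proof -
    have "(\<lambda>z. W (of_real R * z)) holomorphic_on ball 0 1"
      by (rule holomorphic_on_compose_gen[OF _ W, unfolded o_def])
         (use Rz in \<open>auto intro!: holomorphic_intros\<close>)
    then show ?thesis unfolding V_def by (rule holomorphic_on_power)
  qed
  have norm_V: "norm (V (cis t)) = \<phi> t" for t by (simp add: V_def \<phi>_def norm_power)
  have \<phi>_cont: "continuous_on A \<phi>" for A
    unfolding \<phi>_def using continuous_on_cis_image[OF W_cont] R by (intro continuous_intros) auto
  have \<phi>_nonneg: "0 \<le> \<phi> t" for t by (simp add: \<phi>_def)
  have \<phi>_per: "\<phi> (t + 2 * pi) = \<phi> t" for t
    using cis_add_2pi_int[of t 1] by (simp add: \<phi>_def)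
  have \<phi>_int: "\<phi> integrable_on {a..b}" for a b
    by (intro integrable_continuous_real \<phi>_cont)
  have S_meas: "?S \<in> sets lebesgue"
    using R by (intro radial_superlevel_measurable W_cont) auto
  \<comment> \<open>An arc of half-length at most \<open>pi\<close> about a point of
    \<open>{0..2 * pi}\<close> stays inside \<open>{- pi..3 * pi}\<close>.\<close>
  have "emeasure lebesgue ?S \<le> ennreal (10 / (y / 16) * integral {- pi..3 * pi} \<phi>)"
  proof (rule Hardy_Littlewood_weak_type[OF _ _ _ S_meas])
    fix t assume "t \<in> ?S"
    then obtain r where t: "0 \<le> t" "t \<le> 2 * pi" and r: "0 \<le> r" "r < R"
        "y < (norm (W (of_real r * cis t)))\<^sup>2" by auto
    define \<rho> where "\<rho> = r / R"
    have \<rho>: "0 \<le> \<rho>" "\<rho> < 1" using r R by (auto simp: \<rho>_def)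
    let ?P = "poisson_kernel (of_real \<rho> * cis t)"
    have norm_z: "norm (of_real \<rho> * cis t) < 1" using \<rho> by (simp add: norm_mult)
    have "y < norm (V (of_real \<rho> * cis t))"
      using r R by (simp add: V_def norm_power \<rho>_def mult.assoc)
    also have "\<dots> \<le> 1 / (2 * pi) * integral {0..2 * pi} (\<lambda>s. \<phi> s * ?P s)"
      using norm_le_poisson_integral[OF V_holo V_cont norm_z] by (simp add: norm_V)
    also have "integral {0..2 * pi} (\<lambda>s. \<phi> s * ?P s)
        = integral {t - pi..t - pi + 2 * pi} (\<lambda>s. \<phi> s * ?P s)"
    proof (rule integral_periodic[symmetric])
      show "continuous_on UNIV (\<lambda>s. \<phi> s * ?P s)"
        using norm_z by (intro continuous_intros \<phi>_cont)
    qed (use \<phi>_per cis_add_2pi_int[of _ 1] in \<open>simp add: poisson_kernel_def\<close>)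
    finally have large: "2 * pi * y < integral {t - pi..t + pi} (\<lambda>s. \<phi> s * ?P s)"
      by (simp add: field_simps)
    have "\<exists>x. 1 - \<rho> \<le> x \<and> x \<le> 1 \<and> pi * y / 16 * x \<le> integral {t - pi * x..t + pi * x} \<phi>"
    proof (rule ccontr)
      assume no: "\<not> ?thesis"
      have small: "integral {t - pi * x..t + pi * x} \<phi> \<le> pi * y / 16 * x * (x / (1 - \<rho>)) powr 0"
        if "1 - \<rho> \<le> x" "x \<le> 1" for x
      proof -
        have "integral {t - pi * x..t + pi * x} \<phi> \<le> pi * y / 16 * x"
          using no that by (meson linear)
        then show ?thesis using that \<rho> by simp
      qed
      \<comment> \<open>With \<open>b = 0\<close> the dyadic constant is 32; the threshold
        \<open>pi * y / 16\<close> is chosen so that the product is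
        \<open>2 * pi * y\<close>.\<close>
      have "integral {t - pi..t + pi} (\<lambda>s. \<phi> s * ?P s)
          \<le> 8 * 2 powr (1 - 0) / (1 - 2 powr (0 - 1)) * (pi * y / 16)"
        by (rule poisson_integral_le_of_interval_growth[OF \<rho> _ \<phi>_cont \<phi>_nonneg small]) auto
      also have "\<dots> = 2 * pi * y" by (simp add: powr_minus)
      finally show False using large by simp
    qed
    then obtain x where x: "1 - \<rho> \<le> x" "x \<le> 1"
      "pi * y / 16 * x \<le> integral {t - pi * x..t + pi * x} \<phi>" by blast
    have "pi * x \<le> pi" using mult_left_le[OF x(2), of pi] by simp
    then have "{t - pi * x..t + pi * x} \<subseteq> {- pi..3 * pi}"
      using t unfolding atLeastatMost_subset_iff by linarith
    then show "\<exists>x>0. {t - x..t + x} \<subseteq> {- pi..3 * pi} \<and> y / 16 * x \<le> integral {t - x..t + x} \<phi>"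
      using x \<rho> by (intro exI[of _ "pi * x"]) (simp add: mult_ac)
  qed (use y \<phi>_cont \<phi>_nonneg in auto)
  also have "integral {- pi..3 * pi} \<phi> = integral {- pi..pi} \<phi> + integral {pi..3 * pi} \<phi>"
    using Henstock_Kurzweil_Integration.integral_combine[of "- pi" pi "3 * pi" \<phi>] \<phi>_int by simp
  also have "integral {- pi..pi} \<phi> = integral {0..2 * pi} \<phi>"
    using integral_periodic[of \<phi> "- pi"] \<phi>_per \<phi>_cont by simp
  also have "integral {pi..3 * pi} \<phi> = integral {0..2 * pi} \<phi>"
    using integral_periodic[of \<phi> pi] \<phi>_per \<phi>_cont by simp
  finally show ?thesis by (simp add: \<phi>_def[abs_def])
qed

text \<open>The superlevel sets for radii below \<open>R n\<close> increase to the full one as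
  \<open>R n\<close> tends to 1, so the uniform bound survives by continuity of the measure from
  below.\<close>

lemma radial_maximal_weak_type:
  assumes W: "W holomorphic_on ball 0 1" and y: "0 < y"
    and B: "\<And>r. 0 \<le> r \<Longrightarrow> r < 1 \<Longrightarrow> integral {0..2 * pi} (\<lambda>t. (norm (W (of_real r * cis t)))\<^sup>2) \<le> B"
  shows "emeasure lebesgue {t \<in> {0..2 * pi}. \<exists>r\<ge>0. r < 1 \<and> y < (norm (W (of_real r * cis t)))\<^sup>2}
    \<le> ennreal (320 / y * B)"
proof -
  define R where "R n = 1 - 1 / real (n + 2)" for n
  define E where "E n = {t \<in> {0..2 * pi}. \<exists>r\<ge>0. r < R n \<and> y < (norm (W (of_real r * cis t)))\<^sup>2}" for n
  have R: "0 < R n" "R n < 1" for n by (auto simp: R_def)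
  have mono: "incseq R" unfolding R_def by (intro incseq_SucI) (simp add: field_simps)
  have E_meas: "E n \<in> sets lebesgue" for n
    unfolding E_def using R(2)[of n]
    by (intro radial_superlevel_measurable holomorphic_on_imp_continuous_on[OF W]) simp
  have "incseq E"
  proof (rule incseq_SucI)
    fix n show "E n \<subseteq> E (Suc n)"
      using incseq_SucD[OF mono, of n] by (auto simp: E_def intro: less_le_trans)
  qed
  then have "emeasure lebesgue (\<Union>n. E n) = (SUP n. emeasure lebesgue (E n))"
    using E_meas by (intro SUP_emeasure_incseq[symmetric]) auto
  also have "\<dots> \<le> ennreal (320 / y * B)"
  proof (intro SUP_least)
    fix n
    have "emeasure lebesgue (E n)
        \<le> ennreal (320 / y * integral {0..2 * pi} (\<lambda>t. (norm (W (of_real (R n) * cis t)))\<^sup>2))"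
      unfolding E_def by (intro radial_maximal_weak_type_aux W R y)
    also have "\<dots> \<le> ennreal (320 / y * B)"
      using y R[of n] by (intro ennreal_leI mult_left_mono B) auto
    finally show "emeasure lebesgue (E n) \<le> ennreal (320 / y * B)" .
  qed
  finally have "emeasure lebesgue (\<Union>n. E n) \<le> ennreal (320 / y * B)" .
  moreover have "{t \<in> {0..2 * pi}. \<exists>r\<ge>0. r < 1 \<and> y < (norm (W (of_real r * cis t)))\<^sup>2} \<subseteq> (\<Union>n. E n)"
  proof
    fix t assume "t \<in> {t \<in> {0..2 * pi}. \<exists>r\<ge>0. r < 1 \<and> y < (norm (W (of_real r * cis t)))\<^sup>2}"
    then obtain r where r: "t \<in> {0..2 * pi}" "0 \<le> r" "r < 1" "y < (norm (W (of_real r * cis t)))\<^sup>2"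
      by auto
    have "R \<longlonglongrightarrow> 1" unfolding R_def by real_asymp
    then have "\<forall>\<^sub>F n in sequentially. r < R n" using r(3) by (rule order_tendstoD)
    then obtain n where "r < R n" by (auto simp: eventually_sequentially)
    then show "t \<in> (\<Union>n. E n)" using r by (auto simp: E_def)
  qed
  then have "emeasure lebesgue {t \<in> {0..2 * pi}. \<exists>r\<ge>0. r < 1 \<and> y < (norm (W (of_real r * cis t)))\<^sup>2}
      \<le> emeasure lebesgue (\<Union>n. E n)"
    using E_meas by (intro emeasure_mono) auto
  ultimately show ?thesis by (rule order_trans[rotated])
qed

text \<open>Bounded square means make the Taylor coefficients square summable, so the remainders
  \<open>W N\<close> have small square means on all circles. By the weak-type bound their radial
  suprema are small off a small set, while \<open>p N\<close> is continuous up to the circle; so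
  \<open>F\<close> is Cauchy along almost every radius. The bound is asked only beyond some radius
  \<open>c\<close> because \<open>integral_arc_le\<close> works for radii at least 1/2.\<close>

theorem Fatou_radial_limit:
  assumes F: "F holomorphic_on ball 0 1"
    and c: "0 \<le> c" "c < 1"
    and B: "\<And>r. c < r \<Longrightarrow> r < 1 \<Longrightarrow> integral {0..2 * pi} (\<lambda>t. (norm (F (of_real r * cis t)))\<^sup>2) \<le> B"
  shows "AE t in lebesgue. t \<in> {0..2 * pi} \<longrightarrow>
    (\<exists>l. ((\<lambda>r. F (of_real r * cis t)) \<longlongrightarrow> l) (at_left 1))"
proof -
  define a where "a n = (deriv ^^ n) F 0 / fact n" for n
  have sums: "(\<lambda>n. a n * z ^ n) sums F z" if "norm z < 1" for z
    using holomorphic_power_series[OF F, of z] that by (simp add: a_def)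
  let ?a2 = "\<lambda>n. (norm (a n))\<^sup>2"
  \<comment> \<open>Each partial sum is a polynomial in \<open>r\<close>, so the bound for
    \<open>r\<close> near 1 carries over to \<open>r = 1\<close>.\<close>
  have partial_le: "(\<Sum>n<M. ?a2 n) \<le> B / (2 * pi)" for M
  proof (rule tendsto_upperbound)
    show "((\<lambda>r. \<Sum>n<M. ?a2 n * r ^ (2 * n)) \<longlongrightarrow> (\<Sum>n<M. ?a2 n)) (at_left 1)"
      by (rule tendsto_eq_intros refl | simp)+
    have "(\<Sum>n<M. ?a2 n * r ^ (2 * n)) \<le> B / (2 * pi)" if r: "c < r" "r < 1" for r
    proof -
      have "0 \<le> r" using c r by simp
      note P = power_series_Parseval[OF sums, of r]
      have "(\<Sum>n<M. ?a2 n * r ^ (2 * n)) \<le> (\<Sum>n. ?a2 n * r ^ (2 * n))"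
        using P r \<open>0 \<le> r\<close> by (intro sum_le_suminf) (auto simp: sums_iff)
      also have "\<dots> = 1 / (2 * pi) * integral {0..2 * pi} (\<lambda>t. (norm (F (of_real r * cis t)))\<^sup>2)"
        using P r \<open>0 \<le> r\<close> by (simp add: sums_iff)
      also have "\<dots> \<le> 1 / (2 * pi) * B"
        using B[of r] r by (intro mult_left_mono) auto
      finally show ?thesis by simp
    qed
    then show "\<forall>\<^sub>F r in at_left 1. (\<Sum>n<M. ?a2 n * r ^ (2 * n)) \<le> B / (2 * pi)"
      using eventually_at_left_real[OF c(2)] by (auto elim!: eventually_mono)
  qed simp
  have summ: "summable ?a2"
    by (rule bounded_imp_summable[of _ "B / (2 * pi)"])
       (use partial_le[of "Suc _"] in \<open>auto simp: lessThan_Suc_atMost\<close>)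
  \<comment> \<open>\<open>T N\<close> is the squared Hardy norm of the remainder
    \<open>W N\<close>.\<close>
  define T where "T N = (\<Sum>n. ?a2 (n + N))" for N
  have T: "T \<longlonglongrightarrow> 0"
    unfolding T_def using suminf_exist_split2[OF summ] .
  define p where "p N z = (\<Sum>n<N. a n * z ^ n)" for N z
  define W where "W N z = F z - p N z" for N z
  have W_holo: "W N holomorphic_on ball 0 1" for N
    unfolding W_def[abs_def] p_def by (intro holomorphic_intros F)
  have W_bound: "integral {0..2 * pi} (\<lambda>t. (norm (W N (of_real r * cis t)))\<^sup>2) \<le> 2 * pi * T N"
    if r: "0 \<le> r" "r < 1" for N r
  proof -
    define b where "b n = (if n < N then 0 else a n)" for n
    have "(\<lambda>n. b n * z ^ n) sums W N z" if "norm z < 1" for z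
    proof -
      have "(\<lambda>n. if n \<in> {..<N} then a n * z ^ n else 0) sums p N z"
        unfolding p_def by (rule sums_If_finite_set) simp
      from sums_diff[OF sums[OF that] this] show ?thesis
        by (simp add: W_def b_def if_distrib[of "\<lambda>x. _ - x"] if_distrib[of "\<lambda>x. x * _"] cong: if_cong)
    qed
    from power_series_Parseval[OF this r]
    have P: "(\<lambda>n. (norm (b n))\<^sup>2 * r ^ (2 * n)) sums
      (1 / (2 * pi) * integral {0..2 * pi} (\<lambda>t. (norm (W N (of_real r * cis t)))\<^sup>2))" .
    have "(\<lambda>n. (norm (b (n + N)))\<^sup>2) = (\<lambda>n. ?a2 (n + N))" by (simp add: b_def)
    moreover have summ_b: "summable (\<lambda>n. (norm (b n))\<^sup>2)"
      by (rule summable_comparison_test'[OF summ]) (simp add: b_def)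
    ultimately have sb: "(\<Sum>n. (norm (b n))\<^sup>2) = T N"
      using suminf_split_initial_segment[OF summ_b, of N] by (simp add: T_def b_def)
    have "1 / (2 * pi) * integral {0..2 * pi} (\<lambda>t. (norm (W N (of_real r * cis t)))\<^sup>2) \<le> T N"
      unfolding sb[symmetric] sums_unique[OF P]
      using r P summ_b by (intro suminf_le) (auto simp: sums_iff mult_left_le power_le_one)
    then show ?thesis by (simp add: field_simps)
  qed
  define S where "S N y = {t \<in> {0..2 * pi}. \<exists>r\<ge>0. r < 1 \<and> y < (norm (W N (of_real r * cis t)))\<^sup>2}" for N y
  \<comment> \<open>A point of the intersection is bad for every remainder, so the weak-type
    estimate bounds the measure for each \<open>N\<close>, and these bounds tend to 0.\<close>
  have null: "negligible (\<Inter>N. S N y)" if y: "0 < y" for y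
    unfolding negligible_outer_le
  proof (intro allI impI)
    fix e :: real assume e: "0 < e"
    have "(\<lambda>N. 320 / y * (2 * pi * T N)) \<longlonglongrightarrow> 320 / y * (2 * pi * 0)"
      by (intro tendsto_intros T)
    then have "\<forall>\<^sub>F N in sequentially. 320 / y * (2 * pi * T N) < e"
      using e by (intro order_tendstoD) auto
    then obtain N where N: "320 / y * (2 * pi * T N) < e" by (auto simp: eventually_sequentially)
    have meas: "S N y \<in> sets lebesgue"
      unfolding S_def by (intro radial_superlevel_measurable holomorphic_on_imp_continuous_on W_holo) simp
    have "emeasure lebesgue (S N y) \<le> ennreal (320 / y * (2 * pi * T N))"
      unfolding S_def by (intro radial_maximal_weak_type[OF W_holo y W_bound])
    also have "\<dots> \<le> ennreal e" using N by (intro ennreal_leI) simp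
    finally have le: "emeasure lebesgue (S N y) \<le> ennreal e" .
    then have "S N y \<in> lmeasurable"
      using meas by (intro fmeasurableI) (auto intro: le_less_trans)
    moreover have "measure lebesgue (S N y) \<le> e"
      using le e by (simp add: measure_def enn2real_leI)
    ultimately show "\<exists>T. (\<Inter>N. S N y) \<subseteq> T \<and> T \<in> lmeasurable \<and> measure lebesgue T \<le> e"
      by blast
  qed
  \<comment> \<open>Off \<open>Z\<close>, for every \<open>m\<close> some remainder has modulus at
    most \<open>1 / real (Suc m)\<close> along the whole radius. The threshold is squared because
    \<open>S\<close> is defined by the squared modulus.\<close>
  define Z where "Z = (\<Union>m. \<Inter>N. S N ((1 / real (Suc m))\<^sup>2))"
  have "negligible Z"
    unfolding Z_def by (intro negligible_countable_Union) (auto intro!: null)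
  then have "AE t in lebesgue. t \<notin> Z"
    by (simp add: negligible_iff_null_sets AE_not_in)
  then show ?thesis
  proof (rule AE_mp, intro AE_I2 impI)
    fix t assume t: "t \<notin> Z" "t \<in> {0..2 * pi}"
    let ?f = "\<lambda>r. F (of_real r * cis t)"
    have "cauchy_filter (filtermap ?f (at_left 1))"
      unfolding cauchy_filter_metric_filtermap
    proof (intro allI impI)
      fix e :: real assume e: "0 < e"
      obtain m where m: "1 / real (Suc m) < e / 4"
        using nat_approx_posE[of "e / 4"] e by auto
      obtain N where "t \<notin> S N ((1 / real (Suc m))\<^sup>2)" using t by (auto simp: Z_def)
      then have "(norm (W N (of_real r * cis t)))\<^sup>2 \<le> (1 / real (Suc m))\<^sup>2" if "0 \<le> r" "r < 1" for r
        using that t(2) by (force simp: S_def not_less)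
      then have W_le: "norm (W N (of_real r * cis t)) \<le> e / 4" if "0 \<le> r" "r < 1" for r
        using that m by (meson abs_le_square_iff less_imp_le order_trans power2_le_imp_le divide_nonneg_nonneg of_nat_0_le_iff zero_le_one)
      have "((\<lambda>r. p N (of_real r * cis t)) \<longlongrightarrow> p N (of_real 1 * cis t)) (at_left 1)"
        unfolding p_def by (intro tendsto_intros)
      then have "\<forall>\<^sub>F r in at_left 1. dist (p N (of_real r * cis t)) (p N (of_real 1 * cis t)) < e / 4"
        using e by (intro tendstoD) auto
      moreover have "\<forall>\<^sub>F r in at_left 1. (0::real) < r \<and> r < 1"
        using eventually_at_left_real[of 0 "1::real"] by simp
      ultimately have ev: "\<forall>\<^sub>F r in at_left 1.
          dist (p N (of_real r * cis t)) (p N (of_real 1 * cis t)) < e / 4 \<and> 0 < r \<and> r < 1"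
        by eventually_elim auto
      \<comment> \<open>The allowance of \<open>e / 2\<close> is split into \<open>e / 4\<close> for
        the remainder and \<open>e / 4\<close> for the continuity of the polynomial at the boundary
        point.\<close>
      have close: "dist (?f x) (p N (of_real 1 * cis t)) < e / 2"
        if "dist (p N (of_real x * cis t)) (p N (of_real 1 * cis t)) < e / 4 \<and> 0 < x \<and> x < 1" for x
      proof -
        have "dist (?f x) (p N (of_real x * cis t)) \<le> e / 4"
          using W_le[of x] that by (simp add: W_def dist_norm)
        then show ?thesis
          using that dist_triangle[of "?f x" "p N (of_real 1 * cis t)" "p N (of_real x * cis t)"] by simp
      qed
      have "dist (?f x) (?f y) < e"
        if "dist (p N (of_real x * cis t)) (p N (of_real 1 * cis t)) < e / 4 \<and> 0 < x \<and> x < 1"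
           "dist (p N (of_real y * cis t)) (p N (of_real 1 * cis t)) < e / 4 \<and> 0 < y \<and> y < 1" for x y
        using close[OF that(1)] close[OF that(2)] by (rule dist_triangle_half_l)
      then show "\<exists>P. eventually P (at_left 1) \<and> (\<forall>x y. P x \<and> P y \<longrightarrow> dist (?f x) (?f y) < e)"
        using ev by blast
    qed
    moreover have "complete (UNIV :: complex set)" by (rule complete_UNIV)
    ultimately obtain l where "filtermap ?f (at_left 1) \<le> nhds l"
      unfolding complete_uniform
      by (metis filtermap_bot_iff principal_UNIV top_greatest trivial_limit_at_left_real)
    then show "\<exists>l. (?f \<longlongrightarrow> l) (at_left 1)" by (auto simp: filterlim_def)
  qed
qed

section \<open>Length of smooth paths\<close>

text \<open>The mean value inequality with endpoints in either order, since angles lie on both sides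
  of the reference angle \<open>\<alpha>\<close>.\<close>

lemma vector_derivative_bound:
  fixes F :: "real \<Rightarrow> 'a::real_normed_vector"
  assumes "\<And>x. x \<in> {min a b..max a b} \<Longrightarrow> (F has_vector_derivative F' x) (at x within {min a b..max a b})"
    and "\<And>x. x \<in> {min a b..max a b} \<Longrightarrow> norm (F' x) \<le> B"
  shows "norm (F b - F a) \<le> B * \<bar>b - a\<bar>"
proof -
  have *: "norm (F d - F c) \<le> B * (d - c)" if "c < d" "{c..d} = {min a b..max a b}" for c d
  proof -
    have "norm (F d - F c) \<le> B * d - B * c"
    proof (rule differentiable_bound_general[OF that(1)])
      show "continuous_on {c..d} F"
        unfolding that(2) continuous_on_eq_continuous_within
        using assms(1) has_vector_derivative_continuous by blast
      show "(F has_vector_derivative F' x) (at x)" if x: "c < x" "x < d" for x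
        using assms(1)[of x] x \<open>{c..d} = _\<close> at_within_Icc_at[of c x d] by (metis atLeastAtMost_iff less_imp_le)
      show "norm (F' x) \<le> B" if x: "c < x" "x < d" for x
        using assms(2)[of x] x \<open>{c..d} = _\<close> by (metis atLeastAtMost_iff less_imp_le)
      show "((\<lambda>x. B * x) has_vector_derivative B) (at x)" for x
        by (auto intro!: derivative_eq_intros simp: has_vector_derivative_def)
    qed (auto intro!: continuous_intros)
    then show ?thesis by (simp add: right_diff_distrib)
  qed
  consider "a < b" | "b < a" | "a = b" by linarith
  then show ?thesis
  proof cases
    case 1 then show ?thesis using *[of a b] by simp
  next
    case 2 then show ?thesis using *[of b a] by (simp add: norm_minus_commute)
  qed simp
qed

text \<open>On a fine uniform partition, uniform continuity of \<open>p'\<close> makes each chord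
  nearly equal to the step times \<open>p'\<close> at the left node, so chord length and integral of
  the speed nearly agree. The chord sums are among those in the supremum that defines
  \<open>path_length\<close>.\<close>

lemma path_length_ge_integral:
  assumes deriv: "\<And>t. t \<in> {0..1} \<Longrightarrow> (p has_vector_derivative p' t) (at t within {0..1})"
    and cont: "continuous_on {0..1} p'"
  shows "ennreal (integral {0..1} (\<lambda>t. norm (p' t))) \<le> path_length p"
proof (rule ennreal_le_epsilon)
  fix e :: real assume e: "0 < e"
  \<comment> \<open>Each of the \<open>N\<close> subintervals costs
    \<open>2 * \<epsilon> / N\<close>: half of it for the chord and half for the integral.\<close>
  define \<epsilon> where "\<epsilon> = e / 2"
  have \<epsilon>: "0 < \<epsilon>" using e by (simp add: \<epsilon>_def)
  have "uniformly_continuous_on {0..1} p'"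
    using cont by (intro compact_uniformly_continuous) auto
  then obtain \<delta> where \<delta>: "0 < \<delta>"
      "\<And>s t. s \<in> {0..1} \<Longrightarrow> t \<in> {0..1} \<Longrightarrow> dist s t < \<delta> \<Longrightarrow> dist (p' s) (p' t) < \<epsilon>"
    using \<epsilon> unfolding uniformly_continuous_on_def by metis
  obtain n where n: "1 / real (Suc n) < \<delta>" using nat_approx_posE[OF \<delta>(1)] by auto
  define N where "N = Suc n"
  define t where "t i = real i / real N" for i
  have N: "0 < real N" by (simp add: N_def)
  have t_Suc: "t (Suc i) - t i = 1 / real N" for i by (simp add: t_def diff_divide_distrib[symmetric])
  have t_le: "t i < t (Suc i)" for i using t_Suc[of i] N by (smt (verit) divide_pos_pos)
  have t_in: "t i \<in> {0..1}" if "i \<le> N" for i using that N by (auto simp: t_def)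
  have int: "(\<lambda>s. norm (p' s)) integrable_on {c..d}" if "{c..d} \<subseteq> {0..1}" for c d
    using continuous_on_subset[OF cont that] by (intro integrable_continuous_real continuous_intros)
  have step: "integral {t i..t (Suc i)} (\<lambda>s. norm (p' s)) \<le> dist (p (t i)) (p (t (Suc i))) + 2 * \<epsilon> / N"
    if i: "i < N" for i
  proof -
    let ?I = "{t i..t (Suc i)}"
    have I: "?I \<subseteq> {0..1}" using t_in[of i] t_in[of "Suc i"] i by auto
    have close: "norm (p' s - p' (t i)) \<le> \<epsilon>" if "s \<in> ?I" for s
    proof -
      have "dist s (t i) \<le> 1 / real N" using that t_Suc[of i] by (auto simp: dist_real_def)
      then have "dist s (t i) < \<delta>" using n by (simp add: N_def)
      then show ?thesis using \<delta>(2)[of s "t i"] that I t_in[of i] i by (auto simp: dist_norm intro: less_imp_le)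
    qed
    \<comment> \<open>Subtracting the linear function with slope \<open>p' (t i)\<close> leaves a
      derivative of norm at most \<open>\<epsilon>\<close>.\<close>
    have "norm ((p (t (Suc i)) - t (Suc i) *\<^sub>R p' (t i)) - (p (t i) - t i *\<^sub>R p' (t i)))
        \<le> \<epsilon> * \<bar>t (Suc i) - t i\<bar>"
    proof (rule vector_derivative_bound)
      have I_eq: "{min (t i) (t (Suc i))..max (t i) (t (Suc i))} = ?I" using t_le[of i] by simp
      fix s assume "s \<in> {min (t i) (t (Suc i))..max (t i) (t (Suc i))}"
      then have s: "s \<in> ?I" by (simp only: I_eq)
      have "(p has_vector_derivative p' s) (at s within ?I)"
        using deriv[of s] s I by (auto intro: has_vector_derivative_within_subset)
      then show "((\<lambda>s. p s - s *\<^sub>R p' (t i)) has_vector_derivative p' s - p' (t i))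
          (at s within {min (t i) (t (Suc i))..max (t i) (t (Suc i))})"
        unfolding I_eq by (auto intro!: derivative_eq_intros)
      show "norm (p' s - p' (t i)) \<le> \<epsilon>" using close[OF s] .
    qed
    also have "(p (t (Suc i)) - t (Suc i) *\<^sub>R p' (t i)) - (p (t i) - t i *\<^sub>R p' (t i))
        = (p (t (Suc i)) - p (t i)) - (1 / real N) *\<^sub>R p' (t i)"
      by (simp add: algebra_simps flip: t_Suc[of i])
    finally have "norm ((1 / real N) *\<^sub>R p' (t i)) \<le> dist (p (t i)) (p (t (Suc i))) + \<epsilon> / N"
      using norm_triangle_ineq2[of "(1 / real N) *\<^sub>R p' (t i)" "p (t (Suc i)) - p (t i)"]
      by (simp add: t_Suc dist_norm norm_minus_commute)
    then have 1: "norm (p' (t i)) * (1 / N) \<le> dist (p (t i)) (p (t (Suc i))) + \<epsilon> / N"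
      using N by simp
    have "integral ?I (\<lambda>s. norm (p' s)) \<le> integral ?I (\<lambda>s. norm (p' (t i)) + \<epsilon>)"
    proof (intro integral_le int I)
      show "norm (p' s) \<le> norm (p' (t i)) + \<epsilon>" if "s \<in> ?I" for s
        using close[OF that] norm_triangle_ineq2[of "p' s" "p' (t i)"] by linarith
    qed (rule integrable_const_ivl)
    also have "\<dots> = (norm (p' (t i)) + \<epsilon>) * (1 / N)"
      using t_le[of i] t_Suc[of i] by simp
    also have "\<dots> = norm (p' (t i)) * (1 / N) + \<epsilon> / N" by (simp add: add_divide_distrib)
    finally show ?thesis using 1 by (simp add: add_divide_distrib)
  qed
  have combine: "integral {0..t k} (\<lambda>s. norm (p' s)) = (\<Sum>i<k. integral {t i..t (Suc i)} (\<lambda>s. norm (p' s)))"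
    if "k \<le> N" for k
    using that
  proof (induction k)
    case (Suc k)
    have "integral {0..t (Suc k)} (\<lambda>s. norm (p' s))
        = integral {0..t k} (\<lambda>s. norm (p' s)) + integral {t k..t (Suc k)} (\<lambda>s. norm (p' s))"
      using t_in[of k] t_in[of "Suc k"] Suc.prems t_le[of k]
      by (intro Henstock_Kurzweil_Integration.integral_combine[symmetric] int) auto
    then show ?case using Suc by simp
  qed (simp add: t_def)
  have tN: "t N = 1" using N by (simp add: t_def)
  have "integral {0..1} (\<lambda>s. norm (p' s)) \<le> (\<Sum>i<N. dist (p (t i)) (p (t (Suc i))) + 2 * \<epsilon> / N)"
    using combine[of N] sum_mono[of "{..<N}", OF step] by (simp add: tN)
  also have "\<dots> = (\<Sum>i<N. dist (p (t i)) (p (t (Suc i)))) + e"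
    using N by (simp add: sum.distrib \<epsilon>_def)
  finally have "ennreal (integral {0..1} (\<lambda>s. norm (p' s)))
      \<le> ennreal ((\<Sum>i<N. dist (p (t i)) (p (t (Suc i)))) + e)"
    by (rule ennreal_leI)
  also have "\<dots> = (\<Sum>i<N. ennreal (dist (p (t i)) (p (t (Suc i))))) + ennreal e"
    using e by (simp add: ennreal_plus sum_nonneg)
  also have "(\<Sum>i<N. ennreal (dist (p (t i)) (p (t (Suc i))))) \<le> path_length p"
    unfolding path_length_def
  proof (rule SUP_upper2[of "(N, t)"])
    have "mono_on {..N} t" by (auto simp: mono_on_def t_def divide_right_mono)
    moreover have "t ` {..N} \<subseteq> {0..1}" using t_in by auto
    ultimately show "(N, t) \<in> {(n, t). mono_on {..n} t \<and> t ` {..n} \<subseteq> {0..1}}" by simp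
  qed simp
  finally show "ennreal (integral {0..1} (\<lambda>s. norm (p' s))) \<le> path_length p + ennreal e"
    by (simp add: add_right_mono)
qed

text \<open>Clockwise arcs have \<open>b < a\<close>; hence the absolute value and the use of
  \<open>min\<close> and \<open>max\<close> in the substitution.\<close>

lemma integral_affine_unit:
  fixes \<phi> :: "real \<Rightarrow> real"
  assumes "a \<noteq> b" "\<phi> integrable_on {min a b..max a b}"
  shows "integral {0..1} (\<lambda>t. \<bar>b - a\<bar> * \<phi> (a + (b - a) * t)) = integral {min a b..max a b} \<phi>"
proof -
  have img: "(\<lambda>x. (1 / (b - a)) *\<^sub>R x + - ((1 / (b - a)) *\<^sub>R a)) ` cbox (min a b) (max a b) = {0..1}"
  proof -
    have "(\<lambda>x. (1 / (b - a)) *\<^sub>R x + - ((1 / (b - a)) *\<^sub>R a)) = (\<lambda>x. (x - a) / (b - a))"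
      by (auto simp: fun_eq_iff diff_divide_distrib)
    moreover have "(\<lambda>x. (x - a) / (b - a)) ` {min a b..max a b} = {0..1}"
    proof (intro equalityI subsetI)
      fix y :: real assume "y \<in> {0..1}"
      then have y: "0 \<le> y" "y \<le> 1" by auto
      have "a + (b - a) * y = (1 - y) * a + y * b" by (simp add: algebra_simps)
      moreover have "(1 - y) * min a b + y * min a b \<le> (1 - y) * a + y * b"
        using y by (intro add_mono mult_left_mono) auto
      moreover have "(1 - y) * a + y * b \<le> (1 - y) * max a b + y * max a b"
        using y by (intro add_mono mult_left_mono) auto
      ultimately have "a + (b - a) * y \<in> {min a b..max a b}"
        by (simp add: algebra_simps)
      then show "y \<in> (\<lambda>x. (x - a) / (b - a)) ` {min a b..max a b}"
        using assms(1) by (intro image_eqI[of _ _ "a + (b - a) * y"]) auto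
    qed (use assms(1) in \<open>auto simp: min_def max_def divide_simps split: if_splits\<close>)
    ultimately show ?thesis by (simp only: interval_cbox)
  qed
  have "(\<phi> has_integral integral {min a b..max a b} \<phi>) (cbox (min a b) (max a b))"
    using assms(2) by (simp add: integrable_integral)
  from has_integral_affinity[OF this, of "b - a" a]
  have "((\<lambda>t. \<phi> ((b - a) *\<^sub>R t + a)) has_integral
      (1 / \<bar>b - a\<bar>) * integral {min a b..max a b} \<phi>) {0..1}"
    using assms(1) unfolding img by simp
  from has_integral_mult_right[OF this, of "\<bar>b - a\<bar>"] show ?thesis
    using assms(1) by (intro integral_unique) (simp add: add.commute)
qed

section \<open>Harmonic maps\<close>

locale harmonic_map =
  fixes f h g :: "complex \<Rightarrow> complex"
  assumes decomposition: "canonical_decomposition f h g"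
    and inj: "inj_on f (ball 0 1)"
    and sense_preserving: "\<And>z. z \<in> ball 0 1 \<Longrightarrow> jacobian f z > 0"
begin

lemma h_holo: "h holomorphic_on ball 0 1" and g_holo: "g holomorphic_on ball 0 1"
  and f_eq: "\<And>z. z \<in> ball 0 1 \<Longrightarrow> f z = h z + cnj (g z)"
  using decomposition by (auto simp: canonical_decomposition_def)

lemma h'_holo: "deriv h holomorphic_on ball 0 1" and g'_holo: "deriv g holomorphic_on ball 0 1"
  by (auto intro!: holomorphic_deriv h_holo g_holo)

lemma f_has_derivative:
  assumes z: "z \<in> ball 0 1"
  shows "(f has_derivative (\<lambda>v. deriv h z * v + cnj (deriv g z * v))) (at z)"
proof -
  have "(h has_derivative (\<lambda>v. deriv h z * v)) (at z)" "(g has_derivative (\<lambda>v. deriv g z * v)) (at z)"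
    using holomorphic_derivI[OF h_holo open_ball z] holomorphic_derivI[OF g_holo open_ball z]
    by (simp_all add: has_field_derivative_def)
  then have "((\<lambda>z. h z + cnj (g z)) has_derivative (\<lambda>v. deriv h z * v + cnj (deriv g z * v))) (at z)"
    by (intro has_derivative_add has_derivative_cnj)
  then show ?thesis
    by (rule has_derivative_transform_within_open[OF _ open_ball z]) (simp add: f_eq)
qed

lemma wirtinger_eq:
  assumes z: "z \<in> ball 0 1"
  shows "wirtinger_z f z = deriv h z" "wirtinger_zbar f z = cnj (deriv g z)"
  unfolding wirtinger_z_def wirtinger_zbar_def frechet_derivative_at[OF f_has_derivative[OF z], symmetric]
  by (auto simp: complex_eq_iff)

lemma norm_D_eq: "z \<in> ball 0 1 \<Longrightarrow> norm_D f z = norm (deriv h z) + norm (deriv g z)"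
  by (simp add: norm_D_def wirtinger_eq)

text \<open>The factors are the largest and the smallest stretching of the differential.
  Quasiconformality compares the two.\<close>

lemma jacobian_eq:
  "z \<in> ball 0 1 \<Longrightarrow> jacobian f z = norm_D f z * (norm (deriv h z) - norm (deriv g z))"
  by (simp add: jacobian_def norm_D_eq wirtinger_eq power2_eq_square algebra_simps)

lemma g'_less_h': "z \<in> ball 0 1 \<Longrightarrow> norm (deriv g z) < norm (deriv h z)"
  using sense_preserving[of z] norm_D_eq[of z] jacobian_eq[of z]
  by (smt (verit) mult_nonneg_nonpos norm_ge_zero)

lemma h'_nonzero: "z \<in> ball 0 1 \<Longrightarrow> deriv h z \<noteq> 0"
  using g'_less_h'[of z] norm_ge_zero[of "deriv g z"] by force

lemma h'_le_norm_D: "z \<in> ball 0 1 \<Longrightarrow> norm (deriv h z) \<le> norm_D f z"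
  and norm_D_le_h': "z \<in> ball 0 1 \<Longrightarrow> norm_D f z \<le> 2 * norm (deriv h z)"
  and norm_D_pos: "z \<in> ball 0 1 \<Longrightarrow> 0 < norm_D f z"
  using norm_D_eq[of z] g'_less_h'[of z] norm_ge_zero[of "deriv g z"] by linarith+

lemma norm_D_nonneg: "0 \<le> norm_D f z"
  by (simp add: norm_D_def)

lemma f_cont: "continuous_on (ball 0 1) f"
  by (rule has_derivative_continuous_on, rule has_derivative_at_withinI, rule f_has_derivative)

lemma h'_cont: "continuous_on (ball 0 1) (deriv h)" and g'_cont: "continuous_on (ball 0 1) (deriv g)"
  using h'_holo g'_holo by (auto intro: holomorphic_on_imp_continuous_on)

lemma norm_D_cont: "continuous_on (ball 0 1) (norm_D f)"
proof -
  have "continuous_on (ball 0 1) (\<lambda>z. norm (deriv h z) + norm (deriv g z))"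
    by (intro continuous_intros h'_cont g'_cont)
  then show ?thesis
    by (rule continuous_on_eq) (simp only: norm_D_eq)
qed

lemma norm_D_circle_cont: "0 \<le> r \<Longrightarrow> r < 1 \<Longrightarrow> continuous_on S (\<lambda>t. norm_D f (of_real r * cis t))"
  by (rule continuous_on_cis_image[OF norm_D_cont])

lemma norm_D_circle_integrable:
  "0 \<le> r \<Longrightarrow> r < 1 \<Longrightarrow> (\<lambda>t. norm_D f (of_real r * cis t)) integrable_on {a..b}"
  by (intro integrable_continuous_real norm_D_circle_cont)

lemma norm_D_circle_periodic: "norm_D f (of_real r * cis (t + 2 * pi)) = norm_D f (of_real r * cis t)"
  using cis_add_2pi_int[of t 1] by simp

lemma f_vector_derivative:
  assumes "(c has_vector_derivative c') (at t within S)" "c t \<in> ball 0 1"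
  shows "((\<lambda>t. f (c t)) has_vector_derivative (deriv h (c t) * c' + cnj (deriv g (c t) * c')))
    (at t within S)"
  using vector_derivative_diff_chain_within[OF assms(1), of f "\<lambda>v. deriv h (c t) * v + cnj (deriv g (c t) * v)"]
    has_derivative_at_withinI[OF f_has_derivative[OF assms(2)]] by (simp add: o_def)

lemma norm_derivative_le:
  assumes "z \<in> ball 0 1"
  shows "norm (deriv h z * v + cnj (deriv g z * v)) \<le> norm_D f z * norm v"
  using norm_triangle_ineq[of "deriv h z * v" "cnj (deriv g z * v)"] assms
  by (simp add: norm_D_eq norm_mult algebra_simps)

lemma norm_derivative_ge:
  assumes "z \<in> ball 0 1"
  shows "(norm (deriv h z) - norm (deriv g z)) * norm v \<le> norm (deriv h z * v + cnj (deriv g z * v))"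
  using norm_triangle_ineq2[of "deriv h z * v" "- cnj (deriv g z * v)"]
  by (simp add: norm_mult algebra_simps)

text \<open>By continuity the inequality fails on an open set. After cancelling a factor
  \<open>norm_D f z\<close>, the almost everywhere hypothesis makes this set null, and a null open
  set is empty.\<close>

lemma distortion_everywhere:
  assumes AE: "AE z in lebesgue. z \<in> ball 0 1 \<longrightarrow> (norm_D f z)\<^sup>2 \<le> K * \<bar>jacobian f z\<bar>"
    and z: "z \<in> ball 0 1"
  shows "norm_D f z \<le> K * (norm (deriv h z) - norm (deriv g z))"
proof -
  let ?J = "\<lambda>z. norm (deriv h z) - norm (deriv g z)"
  define S where "S = {z \<in> ball 0 1. K * ?J z < norm_D f z}"
  have "open S"
  proof -
    have "open (ball 0 1 \<inter> (\<lambda>z. norm_D f z - K * ?J z) -` {0<..})"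
      by (intro continuous_open_preimage continuous_intros norm_D_cont h'_cont g'_cont) auto
    also have "ball 0 1 \<inter> (\<lambda>z. norm_D f z - K * ?J z) -` {0<..} = S"
      by (auto simp: S_def)
    finally show ?thesis .
  qed
  moreover have "negligible S"
  proof -
    have "AE z in lebesgue. z \<notin> S"
      using AE
    proof (rule AE_mp, intro AE_I2 impI notI)
      fix z assume *: "z \<in> ball 0 1 \<longrightarrow> (norm_D f z)\<^sup>2 \<le> K * \<bar>jacobian f z\<bar>" "z \<in> S"
      then have z: "z \<in> ball 0 1" by (simp add: S_def)
      then have "norm_D f z * norm_D f z \<le> norm_D f z * (K * ?J z)"
        using * sense_preserving[OF z] jacobian_eq[OF z] by (simp add: power2_eq_square algebra_simps)
      then have "norm_D f z \<le> K * ?J z"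
        using norm_D_pos[OF z] by (simp add: mult_le_cancel_left)
      then show False using * by (simp add: S_def)
    qed
    then show ?thesis
      using \<open>open S\<close> by (simp add: negligible_iff_null_sets AE_iff_null_sets borel_open lebesgue_openin)
  qed
  ultimately have "S = {}" using open_not_negligible by blast
  then show ?thesis using z by (force simp: S_def not_less)
qed

text \<open>The speed of the image curve is at least \<open>r\<close> times the smallest stretching
  times the angular speed, and the distortion bound replaces the smallest stretching by
  \<open>norm_D / K\<close>.\<close>

lemma path_length_circle_arc_ge:
  assumes K: "\<And>z. z \<in> ball 0 1 \<Longrightarrow> norm_D f z \<le> K * (norm (deriv h z) - norm (deriv g z))" "0 < K"
    and r: "0 \<le> r" "r < 1" and ab: "a \<noteq> b"
  shows "ennreal (r / K * integral {min a b..max a b} (\<lambda>t. norm_D f (of_real r * cis t)))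
    \<le> path_length (f \<circ> part_circlepath 0 r a b)"
proof -
  let ?\<gamma> = "\<lambda>t. of_real r * cis (a + (b - a) * t)"
  define p' where "p' t = deriv h (?\<gamma> t) * (\<i> * of_real (b - a) * ?\<gamma> t)
      + cnj (deriv g (?\<gamma> t) * (\<i> * of_real (b - a) * ?\<gamma> t))" for t
  have \<gamma>_in: "?\<gamma> t \<in> ball 0 1" for t using r by (simp add: norm_mult)
  have \<gamma>_eq: "f \<circ> part_circlepath 0 r a b = (\<lambda>t. f (?\<gamma> t))"
    by (auto simp: fun_eq_iff part_circlepath_def linepath_def cis_conv_exp algebra_simps)
  have \<gamma>_cont: "continuous_on {0..1} ?\<gamma>" by (intro continuous_intros)
  have "(?\<gamma> has_vector_derivative \<i> * of_real (b - a) * ?\<gamma> t) (at t within {0..1})" for t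
    by (auto intro!: derivative_eq_intros simp: has_vector_derivative_def scaleR_conv_of_real fun_eq_iff)
  then have "((\<lambda>t. f (?\<gamma> t)) has_vector_derivative p' t) (at t within {0..1})" for t
    unfolding p'_def by (rule f_vector_derivative) (rule \<gamma>_in)
  moreover have p'_cont: "continuous_on {0..1} p'"
    unfolding p'_def using \<gamma>_in
    by (intro continuous_intros continuous_on_compose2[OF h'_cont \<gamma>_cont]
        continuous_on_compose2[OF g'_cont \<gamma>_cont]) auto
  ultimately have len: "ennreal (integral {0..1} (\<lambda>t. norm (p' t))) \<le> path_length (\<lambda>t. f (?\<gamma> t))"
    by (intro path_length_ge_integral)
  have "r / K * integral {min a b..max a b} (\<lambda>t. norm_D f (of_real r * cis t))
      = r / K * integral {0..1} (\<lambda>t. \<bar>b - a\<bar> * norm_D f (?\<gamma> t))"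
    using integral_affine_unit[OF ab norm_D_circle_integrable[OF r]] by simp
  also have "\<dots> = integral {0..1} (\<lambda>t. r / K * (\<bar>b - a\<bar> * norm_D f (?\<gamma> t)))"
    by simp
  also have "\<dots> \<le> integral {0..1} (\<lambda>t. norm (p' t))"
  proof (rule integral_le)
    show "(\<lambda>t. r / K * (\<bar>b - a\<bar> * norm_D f (?\<gamma> t))) integrable_on {0..1}"
      by (intro integrable_continuous_real continuous_intros continuous_on_compose2[OF norm_D_cont \<gamma>_cont])
        (use \<gamma>_in in auto)
    show "(\<lambda>t. norm (p' t)) integrable_on {0..1}"
      by (intro integrable_continuous_real continuous_intros p'_cont)
    fix t
    have "r / K * (\<bar>b - a\<bar> * norm_D f (?\<gamma> t)) = \<bar>b - a\<bar> * r * (norm_D f (?\<gamma> t) / K)" by simp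
    also have "\<dots> \<le> \<bar>b - a\<bar> * r * (norm (deriv h (?\<gamma> t)) - norm (deriv g (?\<gamma> t)))"
      using K(1)[OF \<gamma>_in[of t]] K(2) r by (intro mult_left_mono) (auto simp: field_simps)
    also have "\<dots> \<le> norm (p' t)"
      using norm_derivative_ge[OF \<gamma>_in[of t], of "\<i> * of_real (b - a) * ?\<gamma> t"] r
      by (simp add: p'_def norm_mult mult_ac flip: of_real_diff)
    finally show "r / K * (\<bar>b - a\<bar> * norm_D f (?\<gamma> t)) \<le> norm (p' t)" .
  qed
  finally show ?thesis unfolding \<gamma>_eq using len ennreal_leI order_trans by blast
qed

end

section \<open>Growth estimates from the bound on the pre-Schwarzian derivative\<close>

locale pre_schwarzian_bounded_map = harmonic_map +
  fixes q :: real
  assumes q: "2 < q" "q < 4"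
    and pre_schwarzian_le: "\<And>z. z \<in> ball 0 1 \<Longrightarrow>
      norm (of_real (1 - (norm z)\<^sup>2) * (deriv (deriv h) z / deriv h z) - 2 * cnj z) \<le> q"
begin

text \<open>The disk is contractible and \<open>deriv h\<close> has no zeros there. The modulus of
  \<open>deriv h\<close> is the exponential of the real part of \<open>L\<close>, so bounds on the
  derivative of \<open>L\<close> integrate to growth estimates.\<close>

lemma holomorphic_log_h':
  obtains L where "L holomorphic_on ball 0 1" "\<And>z. z \<in> ball 0 1 \<Longrightarrow> deriv h z = exp (L z)"
    "\<And>z. z \<in> ball 0 1 \<Longrightarrow> (L has_field_derivative deriv (deriv h) z / deriv h z) (at z)"
proof -
  obtain L where L: "L holomorphic_on ball 0 1" "\<And>z. z \<in> ball 0 1 \<Longrightarrow> deriv h z = exp (L z)"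
    using contractible_imp_holomorphic_log[OF h'_holo] h'_nonzero convex_imp_contractible[OF convex_ball]
    by metis
  have "(L has_field_derivative deriv (deriv h) z / deriv h z) (at z)" if z: "z \<in> ball 0 1" for z
  proof -
    have dL: "(L has_field_derivative deriv L z) (at z)"
      using holomorphic_derivI[OF L(1) open_ball z] by simp
    then have "((\<lambda>z. exp (L z)) has_field_derivative exp (L z) * deriv L z) (at z)"
      by (auto intro!: derivative_eq_intros)
    then have "(deriv h has_field_derivative exp (L z) * deriv L z) (at z)"
      by (rule has_field_derivative_transform_within_open[OF _ open_ball z]) (simp add: L(2))
    then have "deriv (deriv h) z = exp (L z) * deriv L z" by (rule DERIV_imp_deriv)
    then show ?thesis using dL L(2)[OF z] by simp
  qed
  with L that show thesis by blast
qed

text \<open>The 6 is 4 from the bound on \<open>q\<close> plus 2 from the term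
  \<open>2 * cnj z\<close>.\<close>

lemma log_derivative_le:
  assumes z: "z \<in> ball 0 1"
  shows "norm (deriv (deriv h) z / deriv h z) \<le> 6 / (1 - norm z)"
proof -
  let ?w = "deriv (deriv h) z / deriv h z" and ?s = "1 - (norm z)\<^sup>2"
  have n: "norm z < 1" using z by simp
  have s: "1 - norm z \<le> ?s"
    using n by (simp add: power2_eq_square mult_left_le)
  have s_eq: "norm (of_real ?s :: complex) = ?s"
    using s n by (simp only: norm_of_real)
  have "norm (of_real ?s * ?w) \<le> norm (of_real ?s * ?w - 2 * cnj z) + norm (2 * cnj z)"
    by (metis diff_add_cancel norm_triangle_ineq)
  also have "\<dots> \<le> 6"
    using pre_schwarzian_le[OF z] q n by (simp add: norm_mult)
  finally have "?s * norm ?w \<le> 6" unfolding norm_mult[of "of_real ?s"] s_eq .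
  moreover have "(1 - norm z) * norm ?w \<le> ?s * norm ?w"
    using s by (intro mult_right_mono) auto
  ultimately show ?thesis using n by (simp only: pos_le_divide_eq diff_gt_0_iff_gt mult.commute)
qed

text \<open>The bound on the derivative of \<open>L\<close> is integrated along the circle. The
  factor 2 is the price of passing between \<open>norm_D f\<close> and the modulus of
  \<open>deriv h\<close>.\<close>

lemma norm_D_angular_growth:
  assumes \<rho>: "0 \<le> \<rho>" "\<rho> < 1"
  shows "norm_D f (of_real \<rho> * cis \<theta>)
    \<le> 2 * exp (6 * \<bar>\<theta> - \<alpha>\<bar> / (1 - \<rho>)) * norm_D f (of_real \<rho> * cis \<alpha>)"
proof -
  obtain L where L: "\<And>z. z \<in> ball 0 1 \<Longrightarrow> deriv h z = exp (L z)"
    "\<And>z. z \<in> ball 0 1 \<Longrightarrow> (L has_field_derivative deriv (deriv h) z / deriv h z) (at z)"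
    using holomorphic_log_h' by metis
  let ?z = "\<lambda>t. of_real \<rho> * cis t"
  have z_in: "?z t \<in> ball 0 1" for t using \<rho> by (simp add: norm_mult)
  have "norm (L (?z \<theta>) - L (?z \<alpha>)) \<le> 6 / (1 - \<rho>) * \<bar>\<theta> - \<alpha>\<bar>"
  proof (rule vector_derivative_bound[where F = "\<lambda>t. L (?z t)"
        and F' = "\<lambda>t. \<i> * ?z t * (deriv (deriv h) (?z t) / deriv h (?z t))"])
    fix t and S :: "real set"
    have "(?z has_vector_derivative \<i> * ?z t) (at t within S)"
      by (auto intro!: derivative_eq_intros simp: has_vector_derivative_def scaleR_conv_of_real fun_eq_iff)
    from field_vector_diff_chain_within[OF this has_field_derivative_at_within[OF L(2)[OF z_in]]]
    show "((\<lambda>t. L (?z t)) has_vector_derivative \<i> * ?z t * (deriv (deriv h) (?z t) / deriv h (?z t)))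
        (at t within S)"
      by (simp only: o_def)
    have "norm (\<i> * ?z t * (deriv (deriv h) (?z t) / deriv h (?z t)))
        = \<rho> * norm (deriv (deriv h) (?z t) / deriv h (?z t))"
      using \<rho> by (simp add: norm_mult norm_divide)
    also have "\<dots> \<le> 1 * (6 / (1 - \<rho>))"
      using log_derivative_le[OF z_in[of t]] \<rho> by (intro mult_mono) (auto simp: norm_mult)
    finally show "norm (\<i> * ?z t * (deriv (deriv h) (?z t) / deriv h (?z t))) \<le> 6 / (1 - \<rho>)" by simp
  qed
  then have "Re (L (?z \<theta>)) \<le> 6 * \<bar>\<theta> - \<alpha>\<bar> / (1 - \<rho>) + Re (L (?z \<alpha>))"
    using complex_Re_le_cmod[of "L (?z \<theta>) - L (?z \<alpha>)"] by simp
  then have "norm (deriv h (?z \<theta>)) \<le> exp (6 * \<bar>\<theta> - \<alpha>\<bar> / (1 - \<rho>)) * norm (deriv h (?z \<alpha>))"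
    by (simp add: L(1)[OF z_in] flip: exp_add)
  moreover have "\<dots> \<le> exp (6 * \<bar>\<theta> - \<alpha>\<bar> / (1 - \<rho>)) * norm_D f (?z \<alpha>)"
    using h'_le_norm_D[OF z_in] by (intro mult_left_mono) auto
  ultimately show ?thesis using norm_D_le_h'[OF z_in[of \<theta>]] by linarith
qed

text \<open>This is where the strict bound by 4 enters: it makes the exponent \<open>q / 2 - 1\<close> smaller than 1.\<close>

lemma norm_D_radial_growth:
  assumes \<rho>: "0 \<le> \<rho>\<^sub>1" "\<rho>\<^sub>1 \<le> \<rho>\<^sub>2" "\<rho>\<^sub>2 < 1"
  shows "norm_D f (of_real \<rho>\<^sub>1 * cis \<alpha>)
    \<le> 2 * 2 powr (1 + q / 2) * ((1 - \<rho>\<^sub>1) / (1 - \<rho>\<^sub>2)) powr (q / 2 - 1) * norm_D f (of_real \<rho>\<^sub>2 * cis \<alpha>)"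
proof -
  obtain L where L: "\<And>z. z \<in> ball 0 1 \<Longrightarrow> deriv h z = exp (L z)"
    "\<And>z. z \<in> ball 0 1 \<Longrightarrow> (L has_field_derivative deriv (deriv h) z / deriv h z) (at z)"
    using holomorphic_log_h' by metis
  let ?z = "\<lambda>t. of_real t * cis \<alpha>"
  let ?w = "\<lambda>t. deriv (deriv h) (?z t) / deriv h (?z t)"
  \<comment> \<open>The added logarithms have derivative
    \<open>(q - 2 * t) / (1 - t\<^sup>2)\<close>, so monotonicity of \<open>\<psi>\<close> is the
    lower pre-Schwarzian bound along the radius in integrated form.\<close>
  define \<psi> where "\<psi> t = Re (L (?z t)) + ((1 + q / 2) * ln (1 + t) + (1 - q / 2) * ln (1 - t))" for t
  have "\<psi> \<rho>\<^sub>1 \<le> \<psi> \<rho>\<^sub>2"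
  proof (rule DERIV_nonneg_imp_nondecreasing[OF \<rho>(2)])
    fix t assume "\<rho>\<^sub>1 \<le> t" "t \<le> \<rho>\<^sub>2"
    then have t: "0 \<le> t" "t < 1" using \<rho> by auto
    have z: "?z t \<in> ball 0 1" using t by (simp add: norm_mult)
    have "(?z has_vector_derivative cis \<alpha>) (at t)"
      by (auto intro!: derivative_eq_intros simp: has_vector_derivative_def scaleR_conv_of_real fun_eq_iff)
    from field_vector_diff_chain_at[OF this L(2)[OF z]]
    have "((\<lambda>t. L (?z t)) has_vector_derivative cis \<alpha> * ?w t) (at t)" by (simp only: o_def)
    then have "((\<lambda>t. Re (L (?z t))) has_vector_derivative Re (cis \<alpha> * ?w t)) (at t)"
      by (rule bounded_linear.has_vector_derivative[OF bounded_linear_Re])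
    then have dRe: "((\<lambda>t. Re (L (?z t))) has_real_derivative Re (cis \<alpha> * ?w t)) (at t)"
      by (simp only: has_real_derivative_iff_has_vector_derivative)
    let ?d = "Re (cis \<alpha> * ?w t) + ((1 + q / 2) * (1 / (1 + t)) + (1 - q / 2) * (- 1 / (1 - t)))"
    have "((\<lambda>t. (1 + q / 2) * ln (1 + t) + (1 - q / 2) * ln (1 - t)) has_real_derivative
        (1 + q / 2) * (1 / (1 + t)) + (1 - q / 2) * (- 1 / (1 - t))) (at t)"
      using t by (auto intro!: derivative_eq_intros)
    from DERIV_add[OF dRe this] have "(\<psi> has_real_derivative ?d) (at t)"
      unfolding \<psi>_def .
    moreover have "0 \<le> ?d"
    proof -
      have s: "0 < 1 - t\<^sup>2" using t by (simp add: power_less_one_iff abs_square_less_1)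
      \<comment> \<open>Multiplication by \<open>cis \<alpha>\<close> keeps the modulus and makes
        the term with \<open>cnj\<close> real, so a bound on the real part can be read off.\<close>
      have "cis \<alpha> * (of_real (1 - (norm (?z t))\<^sup>2) * ?w t - 2 * cnj (?z t))
          = of_real (1 - t\<^sup>2) * (cis \<alpha> * ?w t) - of_real (2 * t) * (cis \<alpha> * cnj (cis \<alpha>))"
        using t by (simp add: norm_mult algebra_simps)
      also have "cis \<alpha> * cnj (cis \<alpha>) = 1" by (simp add: cis_cnj cis_mult)
      finally have eq: "cis \<alpha> * (of_real (1 - (norm (?z t))\<^sup>2) * ?w t - 2 * cnj (?z t))
          = of_real (1 - t\<^sup>2) * (cis \<alpha> * ?w t) - of_real (2 * t) * 1" .
      have "norm (of_real (1 - t\<^sup>2) * (cis \<alpha> * ?w t) - of_real (2 * t) * 1)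
          = norm (of_real (1 - (norm (?z t))\<^sup>2) * ?w t - 2 * cnj (?z t))"
        unfolding eq[symmetric] norm_mult[of "cis \<alpha>"] by simp
      also have "\<dots> \<le> q" by (rule pre_schwarzian_le[OF z])
      finally have "\<bar>Re (of_real (1 - t\<^sup>2) * (cis \<alpha> * ?w t) - of_real (2 * t) * 1)\<bar> \<le> q"
        using abs_Re_le_cmod order_trans by blast
      moreover have Re_scale: "Re (of_real s * w) = s * Re w" for s :: real and w :: complex
        by simp
      ultimately have "2 * t - q \<le> (1 - t\<^sup>2) * Re (cis \<alpha> * ?w t)"
        by (simp only: minus_complex.sel mult_1_right Re_complex_of_real Re_scale)
      then have "(2 * t - q) / (1 - t\<^sup>2) \<le> Re (cis \<alpha> * ?w t)"
        using s by (simp only: pos_divide_le_eq mult.commute)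
      moreover have "(1 + q / 2) * (1 / (1 + t)) + (1 - q / 2) * (- 1 / (1 - t)) = (q - 2 * t) / (1 - t\<^sup>2)"
      proof -
        have sq: "1 - t\<^sup>2 = (1 + t) * (1 - t)" by (simp add: power2_eq_square algebra_simps)
        have "1 + t \<noteq> 0" "1 - t \<noteq> 0" using t by auto
        then show ?thesis unfolding sq by (simp add: divide_simps) (simp add: algebra_simps)
      qed
      moreover have "(q - 2 * t) / (1 - t\<^sup>2) = - ((2 * t - q) / (1 - t\<^sup>2))"
        by (metis minus_diff_eq minus_divide_left)
      ultimately show ?thesis by linarith
    qed
    ultimately show "\<exists>y. (\<psi> has_real_derivative y) (at t) \<and> 0 \<le> y" by blast
  qed
  \<comment> \<open>The terms with \<open>ln (1 + t)\<close> stay bounded and are absorbed into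
    \<open>2 powr (1 + q / 2)\<close>.\<close>
  moreover have "0 \<le> (1 + q / 2) * ln (1 + \<rho>\<^sub>1)" using \<rho> q by (intro mult_nonneg_nonneg) auto
  moreover have "(1 + q / 2) * ln (1 + \<rho>\<^sub>2) \<le> (1 + q / 2) * ln 2"
    using \<rho> q by (intro mult_left_mono) auto
  moreover have "ln ((1 - \<rho>\<^sub>1) / (1 - \<rho>\<^sub>2)) = ln (1 - \<rho>\<^sub>1) - ln (1 - \<rho>\<^sub>2)"
    using \<rho> by (simp add: ln_div)
  ultimately have "Re (L (?z \<rho>\<^sub>1))
      \<le> (1 + q / 2) * ln 2 + (q / 2 - 1) * ln ((1 - \<rho>\<^sub>1) / (1 - \<rho>\<^sub>2)) + Re (L (?z \<rho>\<^sub>2))"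
    unfolding \<psi>_def by (simp only: left_diff_distrib right_diff_distrib mult_1_left)
  then have "exp (Re (L (?z \<rho>\<^sub>1)))
      \<le> exp ((1 + q / 2) * ln 2) * exp ((q / 2 - 1) * ln ((1 - \<rho>\<^sub>1) / (1 - \<rho>\<^sub>2))) * exp (Re (L (?z \<rho>\<^sub>2)))"
    by (simp flip: exp_add)
  moreover have z: "?z \<rho>\<^sub>1 \<in> ball 0 1" "?z \<rho>\<^sub>2 \<in> ball 0 1" using \<rho> by (auto simp: norm_mult)
  moreover have "0 < (1 - \<rho>\<^sub>1) / (1 - \<rho>\<^sub>2)" using \<rho> by auto
  ultimately have "norm (deriv h (?z \<rho>\<^sub>1))
      \<le> 2 powr (1 + q / 2) * ((1 - \<rho>\<^sub>1) / (1 - \<rho>\<^sub>2)) powr (q / 2 - 1) * norm (deriv h (?z \<rho>\<^sub>2))"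
    using L(1) \<rho> by (auto simp: powr_def)
  also have "\<dots> \<le> 2 powr (1 + q / 2) * ((1 - \<rho>\<^sub>1) / (1 - \<rho>\<^sub>2)) powr (q / 2 - 1) * norm_D f (?z \<rho>\<^sub>2)"
    using h'_le_norm_D[OF z(2)] by (intro mult_left_mono) auto
  finally show ?thesis using norm_D_le_h'[OF z(1)] by linarith
qed

end

section \<open>The Pommerenke condition\<close>

text \<open>The path may cross itself, so an arc with the same endpoints is extracted from it;
  injectivity keeps the inner points of the arc off these endpoints. The arc lies within distance
  \<open>B\<close> of \<open>c\<close>, whence the factor 2.\<close>

lemma interior_diam_dist_le_of_path:
  assumes p: "path p" "pathstart p = w\<^sub>1" "pathfinish p = w\<^sub>2" "w\<^sub>1 \<noteq> w\<^sub>2"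
    and G: "path_image p - {w\<^sub>1, w\<^sub>2} \<subseteq> G"
    and near: "\<And>w. w \<in> path_image p \<Longrightarrow> dist w c \<le> B"
  shows "interior_diam_dist G w\<^sub>1 w\<^sub>2 \<le> ennreal (2 * B)"
proof -
  obtain \<gamma> where \<gamma>: "arc \<gamma>" "path_image \<gamma> \<subseteq> path_image p" "pathstart \<gamma> = w\<^sub>1" "pathfinish \<gamma> = w\<^sub>2"
    using path_contains_arc[OF p] by metis
  have "\<gamma> ` {0<..<1} \<subseteq> G"
  proof
    fix w assume "w \<in> \<gamma> ` {0<..<1}"
    then obtain t where t: "t \<in> {0<..<1}" "w = \<gamma> t" by blast
    have inj: "inj_on \<gamma> {0..1}" using \<gamma>(1) by (simp add: arc_def)
    have "\<gamma> t \<noteq> \<gamma> 0" "\<gamma> t \<noteq> \<gamma> 1"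
      using inj_onD[OF inj, of t 0] inj_onD[OF inj, of t 1] t(1) by auto
    moreover have "\<gamma> t \<in> path_image p" using \<gamma>(2) t(1) by (auto simp: path_image_def)
    ultimately show "w \<in> G" using G \<gamma>(3,4) t(2) by (auto simp: pathstart_def pathfinish_def)
  qed
  then have "interior_diam_dist G w\<^sub>1 w\<^sub>2 \<le> ennreal (diameter (path_image \<gamma>))"
    unfolding interior_diam_dist_def using \<gamma> by (intro INF_lower) auto
  also have "diameter (path_image \<gamma>) \<le> 2 * B"
  proof (rule diameter_le)
    show "path_image \<gamma> \<noteq> {} \<or> 0 \<le> 2 * B" by simp
    fix x y assume "x \<in> path_image \<gamma>" "y \<in> path_image \<gamma>"
    then have "dist x c \<le> B" "dist y c \<le> B" using near \<gamma>(2) by auto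
    then show "norm (x - y) \<le> 2 * B"
      using dist_triangle2[of x y c] by (simp add: dist_norm)
  qed
  finally show ?thesis by (simp add: ennreal_leI)
qed

lemma cis_eq_cis_iff: "cis a = cis b \<longleftrightarrow> (\<exists>k::int. a = b + 2 * pi * of_int k)"
proof
  assume "cis a = cis b"
  then obtain n :: int where "\<i> * of_real a = \<i> * of_real b + (of_int (2 * n) * pi) * \<i>"
    by (auto simp: cis_conv_exp exp_eq)
  then have "Im (\<i> * of_real a) = Im (\<i> * of_real b + (of_int (2 * n) * pi) * \<i>)" by simp
  then show "\<exists>k::int. a = b + 2 * pi * of_int k" by (intro exI[of _ n]) simp
qed (auto simp: cis_add_2pi_int)

lemma exists_half_integral:
  fixes \<phi> :: "real \<Rightarrow> real"
  assumes "a \<le> b" "\<phi> integrable_on {a..b}" "0 \<le> integral {a..b} \<phi>"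
  obtains s where "s \<in> {a..b}" "integral {a..s} \<phi> = integral {a..b} \<phi> / 2"
    "integral {s..b} \<phi> = integral {a..b} \<phi> / 2"
proof -
  have "\<exists>s\<ge>a. s \<le> b \<and> integral {a..s} \<phi> = integral {a..b} \<phi> / 2"
    using assms by (intro IVT' indefinite_integral_continuous_1) auto
  then obtain s where s: "a \<le> s" "s \<le> b" "integral {a..s} \<phi> = integral {a..b} \<phi> / 2" by auto
  then have "integral {s..b} \<phi> = integral {a..b} \<phi> / 2"
    using Henstock_Kurzweil_Integration.integral_combine[of a s b \<phi>] assms by simp
  with s that show thesis by auto
qed

locale pommerenke_growth_map = pre_schwarzian_bounded_map +
  fixes K M C \<delta> :: real
  assumes K: "0 < K" "\<And>z. z \<in> ball 0 1 \<Longrightarrow> norm_D f z \<le> K * (norm (deriv h z) - norm (deriv g z))"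
    and M: "0 < M" "\<And>r w\<^sub>1 w\<^sub>2. 0 < r \<Longrightarrow> r < 1 \<Longrightarrow> w\<^sub>1 \<in> f ` sphere 0 r \<Longrightarrow> w\<^sub>2 \<in> f ` sphere 0 r - {w\<^sub>1} \<Longrightarrow>
      shorter_subarc_length f r w\<^sub>1 w\<^sub>2 / interior_diam_dist (f ` ball 0 r) w\<^sub>1 w\<^sub>2 \<le> ennreal M"
    and \<delta>: "0 < \<delta>" and C: "0 < C"
    and growth: "\<And>\<alpha> \<rho>\<^sub>1 \<rho>\<^sub>2. 0 \<le> \<rho>\<^sub>1 \<Longrightarrow> \<rho>\<^sub>1 \<le> \<rho>\<^sub>2 \<Longrightarrow> \<rho>\<^sub>2 < 1 \<Longrightarrow>
      norm_D f (of_real \<rho>\<^sub>2 * cis \<alpha>)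
        \<le> C * ((1 - \<rho>\<^sub>2) / (1 - \<rho>\<^sub>1)) powr (\<delta> - 1) * norm_D f (of_real \<rho>\<^sub>1 * cis \<alpha>)"
begin

text \<open>The growth hypothesis bounds the speed along the radius by a power of exponent
  \<open>\<delta> - 1\<close>, which is integrable up to the unit circle because
  \<open>\<delta> > 0\<close>.\<close>

lemma dist_radial_le:
  assumes \<rho>: "0 \<le> \<rho>" "\<rho> \<le> t" "t < 1"
  shows "dist (f (of_real t * cis \<theta>)) (f (of_real \<rho> * cis \<theta>))
    \<le> C / \<delta> * (1 - \<rho>) * norm_D f (of_real \<rho> * cis \<theta>)"
proof (cases "\<rho> = t")
  case True
  then show ?thesis using \<rho> C \<delta> norm_D_nonneg[of "of_real \<rho> * cis \<theta>"] by simp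
next
  case False
  then have lt: "\<rho> < t" using \<rho> by simp
  let ?z = "\<lambda>u. of_real u * cis \<theta>"
  let ?D = "norm_D f (?z \<rho>)"
  \<comment> \<open>An antiderivative of the majorant supplied by \<open>growth\<close>, normalised
    to vanish at \<open>u = 1\<close>.\<close>
  define \<Phi> where "\<Phi> u = - (C / \<delta> * (1 - \<rho>) * ((1 - u) / (1 - \<rho>)) powr \<delta> * ?D)" for u
  have z_in: "?z u \<in> ball 0 1" if "\<rho> \<le> u" "u \<le> t" for u using that \<rho> by (simp add: norm_mult)
  have "norm (f (?z t) - f (?z \<rho>)) \<le> \<Phi> t - \<Phi> \<rho>"
  proof (rule differentiable_bound_general[OF lt])
    show "continuous_on {\<rho>..t} (\<lambda>u. f (?z u))"
      by (rule continuous_on_compose2[OF f_cont]) (use z_in in \<open>auto intro!: continuous_intros\<close>)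
    show "continuous_on {\<rho>..t} \<Phi>"
      unfolding \<Phi>_def using \<rho> \<delta> by (intro continuous_intros) auto
    fix u assume u: "\<rho> < u" "u < t"
    have "(?z has_vector_derivative cis \<theta>) (at u)"
      by (auto intro!: derivative_eq_intros simp: has_vector_derivative_def scaleR_conv_of_real fun_eq_iff)
    then show "((\<lambda>u. f (?z u)) has_vector_derivative
        deriv h (?z u) * cis \<theta> + cnj (deriv g (?z u) * cis \<theta>)) (at u)"
      using u by (intro f_vector_derivative z_in) auto
    have inner: "((\<lambda>u. (1 - u) / (1 - \<rho>)) has_real_derivative - 1 / (1 - \<rho>)) (at u)"
      by (intro DERIV_cdivide) (auto intro!: derivative_eq_intros)
    have "((\<lambda>u. - (C / \<delta> * (1 - \<rho>) * ?D) * ((1 - u) / (1 - \<rho>)) powr \<delta>) has_real_derivative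
        - (C / \<delta> * (1 - \<rho>) * ?D) * (\<delta> * ((1 - u) / (1 - \<rho>)) powr (\<delta> - 1) * (- 1 / (1 - \<rho>)))) (at u)"
      using u \<rho> by (intro DERIV_cmult DERIV_chain2[OF has_real_derivative_powr inner]) auto
    moreover have "(\<lambda>u. - (C / \<delta> * (1 - \<rho>) * ?D) * ((1 - u) / (1 - \<rho>)) powr \<delta>) = \<Phi>"
      by (simp add: \<Phi>_def fun_eq_iff)
    moreover have "- (C / \<delta> * (1 - \<rho>) * ?D) * (\<delta> * X * (- 1 / (1 - \<rho>))) = C * X * ?D" for X
      using \<rho> \<delta> by simp
    ultimately have "(\<Phi> has_real_derivative C * ((1 - u) / (1 - \<rho>)) powr (\<delta> - 1) * ?D) (at u)"
      by simp
    then show "(\<Phi> has_vector_derivative C * ((1 - u) / (1 - \<rho>)) powr (\<delta> - 1) * ?D) (at u)"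
      by (simp add: has_real_derivative_iff_has_vector_derivative)
    have "norm (deriv h (?z u) * cis \<theta> + cnj (deriv g (?z u) * cis \<theta>)) \<le> norm_D f (?z u)"
      using norm_derivative_le[OF z_in, of u "cis \<theta>"] u by simp
    also have "\<dots> \<le> C * ((1 - u) / (1 - \<rho>)) powr (\<delta> - 1) * ?D"
      using u \<rho> by (intro growth) auto
    finally show "norm (deriv h (?z u) * cis \<theta> + cnj (deriv g (?z u) * cis \<theta>))
        \<le> C * ((1 - u) / (1 - \<rho>)) powr (\<delta> - 1) * ?D" .
  qed
  also have "\<dots> \<le> - \<Phi> \<rho>"
    using \<rho> C \<delta> norm_D_nonneg[of "?z \<rho>"] by (simp add: \<Phi>_def)
  also have "\<dots> = C / \<delta> * (1 - \<rho>) * ?D" using \<rho> by (simp add: \<Phi>_def)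
  finally show ?thesis by (simp add: dist_norm)
qed

text \<open>The factor of \<open>norm_D_angular_growth\<close> at the largest admissible angle,
  where \<open>\<bar>\<theta> - \<alpha>\<bar> = pi * (1 - \<rho>)\<close>.\<close>

definition angular_const :: real where "angular_const = 2 * exp (6 * pi)"

lemma norm_D_angular_le:
  assumes \<rho>: "0 \<le> \<rho>" "\<rho> < 1" and \<theta>: "\<bar>\<theta> - \<alpha>\<bar> \<le> pi * (1 - \<rho>)"
  shows "norm_D f (of_real \<rho> * cis \<theta>) \<le> angular_const * norm_D f (of_real \<rho> * cis \<alpha>)"
proof -
  have "6 * \<bar>\<theta> - \<alpha>\<bar> / (1 - \<rho>) \<le> 6 * pi"
    using \<rho> \<theta> by (simp add: pos_divide_le_eq)
  then have "2 * exp (6 * \<bar>\<theta> - \<alpha>\<bar> / (1 - \<rho>)) * norm_D f (of_real \<rho> * cis \<alpha>)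
      \<le> angular_const * norm_D f (of_real \<rho> * cis \<alpha>)"
    unfolding angular_const_def by (intro mult_right_mono norm_D_nonneg) auto
  then show ?thesis
    using norm_D_angular_growth[OF \<rho>, of \<theta> \<alpha>] by linarith
qed

lemma dist_angular_le:
  assumes \<rho>: "0 \<le> \<rho>" "\<rho> < 1" and \<theta>: "\<bar>\<theta> - \<alpha>\<bar> \<le> pi * (1 - \<rho>)"
  shows "dist (f (of_real \<rho> * cis \<theta>)) (f (of_real \<rho> * cis \<alpha>))
    \<le> angular_const * pi * (1 - \<rho>) * norm_D f (of_real \<rho> * cis \<alpha>)"
proof -
  let ?z = "\<lambda>u. of_real \<rho> * cis u"
  let ?D = "norm_D f (?z \<alpha>)"
  have z_in: "?z u \<in> ball 0 1" for u using \<rho> by (simp add: norm_mult)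
  have "norm (f (?z \<theta>) - f (?z \<alpha>)) \<le> angular_const * ?D * \<bar>\<theta> - \<alpha>\<bar>"
  proof (rule vector_derivative_bound[where F = "\<lambda>u. f (?z u)"
        and F' = "\<lambda>u. deriv h (?z u) * (\<i> * ?z u) + cnj (deriv g (?z u) * (\<i> * ?z u))"])
    fix u assume u: "u \<in> {min \<alpha> \<theta>..max \<alpha> \<theta>}"
    have "(?z has_vector_derivative \<i> * ?z u) (at u within {min \<alpha> \<theta>..max \<alpha> \<theta>})"
      by (auto intro!: derivative_eq_intros simp: has_vector_derivative_def scaleR_conv_of_real fun_eq_iff)
    then show "((\<lambda>u. f (?z u)) has_vector_derivative
        deriv h (?z u) * (\<i> * ?z u) + cnj (deriv g (?z u) * (\<i> * ?z u))) (at u within {min \<alpha> \<theta>..max \<alpha> \<theta>})"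
      by (intro f_vector_derivative z_in)
    have "norm (deriv h (?z u) * (\<i> * ?z u) + cnj (deriv g (?z u) * (\<i> * ?z u))) \<le> norm_D f (?z u) * \<rho>"
      using norm_derivative_le[OF z_in, of u "\<i> * ?z u"] \<rho> by (simp add: norm_mult)
    also have "\<dots> \<le> norm_D f (?z u)" using \<rho> norm_D_nonneg by (intro mult_left_le) auto
    also have "\<dots> \<le> angular_const * ?D"
      using u \<theta> by (intro norm_D_angular_le \<rho>) (auto simp: min_def max_def split: if_splits)
    finally show "norm (deriv h (?z u) * (\<i> * ?z u) + cnj (deriv g (?z u) * (\<i> * ?z u))) \<le> angular_const * ?D" .
  qed
  also have "\<dots> \<le> angular_const * ?D * (pi * (1 - \<rho>))"
    using \<theta> by (intro mult_left_mono mult_nonneg_nonneg norm_D_nonneg) (auto simp: angular_const_def)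
  finally show ?thesis by (simp add: dist_norm mult_ac)
qed

text \<open>\<open>C / \<delta>\<close> accounts for a radial leg and \<open>pi\<close> for an
  angular one; \<open>angular_const\<close> refers both to the value of \<open>norm_D\<close> at the
  reference point.\<close>

definition diam_const :: real where "diam_const = angular_const * (C / \<delta> + pi)"

lemma diam_const_pos: "0 < diam_const"
  unfolding diam_const_def angular_const_def using C \<delta> by (intro mult_pos_pos add_pos_pos divide_pos_pos) auto

lemma dist_box_le:
  assumes \<rho>: "0 \<le> \<rho>" "\<rho> \<le> t" "t < 1" and \<theta>: "\<bar>\<theta> - \<alpha>\<bar> \<le> pi * (1 - \<rho>)"
  shows "dist (f (of_real t * cis \<theta>)) (f (of_real \<rho> * cis \<alpha>))
    \<le> diam_const * (1 - \<rho>) * norm_D f (of_real \<rho> * cis \<alpha>)"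
proof -
  let ?D = "norm_D f (of_real \<rho> * cis \<alpha>)"
  have "dist (f (of_real t * cis \<theta>)) (f (of_real \<rho> * cis \<theta>)) \<le> C / \<delta> * (1 - \<rho>) * (angular_const * ?D)"
  proof (rule order_trans[OF dist_radial_le[OF \<rho>]])
    show "C / \<delta> * (1 - \<rho>) * norm_D f (of_real \<rho> * cis \<theta>) \<le> C / \<delta> * (1 - \<rho>) * (angular_const * ?D)"
      using \<rho> \<theta> C \<delta> by (intro mult_left_mono norm_D_angular_le) auto
  qed
  moreover have "dist (f (of_real \<rho> * cis \<theta>)) (f (of_real \<rho> * cis \<alpha>)) \<le> angular_const * pi * (1 - \<rho>) * ?D"
    using \<rho> \<theta> by (intro dist_angular_le) auto
  moreover have "diam_const * (1 - \<rho>) * ?D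
      = C / \<delta> * (1 - \<rho>) * (angular_const * ?D) + angular_const * pi * (1 - \<rho>) * ?D"
    by (simp add: diam_const_def algebra_simps)
  ultimately show ?thesis
    using dist_triangle[of "f (of_real t * cis \<theta>)" "f (of_real \<rho> * cis \<alpha>)" "f (of_real \<rho> * cis \<theta>)"]
    by linarith
qed

text \<open>The competing path is the image of \<open>P\<close>, all of whose points obey
  \<open>dist_box_le\<close>. The endpoints are assumed distinct because an arc has to be extracted
  between them.\<close>

lemma interior_diam_dist_le:
  assumes \<rho>: "0 \<le> \<rho>" "\<rho> < r" "r < 1"
    and \<theta>: "\<bar>\<theta>\<^sub>1 - \<alpha>\<bar> \<le> pi * (1 - \<rho>)" "\<bar>\<theta>\<^sub>2 - \<alpha>\<bar> \<le> pi * (1 - \<rho>)"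
    and neq: "f (of_real r * cis \<theta>\<^sub>1) \<noteq> f (of_real r * cis \<theta>\<^sub>2)"
  shows "interior_diam_dist (f ` ball 0 r) (f (of_real r * cis \<theta>\<^sub>1)) (f (of_real r * cis \<theta>\<^sub>2))
    \<le> ennreal (2 * (diam_const * (1 - \<rho>) * norm_D f (of_real \<rho> * cis \<alpha>)))"
proof -
  define P where "P = linepath (of_real r * cis \<theta>\<^sub>1) (of_real \<rho> * cis \<theta>\<^sub>1)
    +++ (part_circlepath 0 \<rho> \<theta>\<^sub>1 \<theta>\<^sub>2 +++ linepath (of_real \<rho> * cis \<theta>\<^sub>2) (of_real r * cis \<theta>\<^sub>2))"
  have radial: "\<exists>t\<in>{\<rho>..r}. z = of_real t * cis \<theta>"
    if seg: "z \<in> closed_segment (of_real r * cis \<theta>) (of_real \<rho> * cis \<theta>)" for z \<theta>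
  proof -
    obtain u where u: "0 \<le> u" "u \<le> 1" "z = (1 - u) *\<^sub>R (of_real r * cis \<theta>) + u *\<^sub>R (of_real \<rho> * cis \<theta>)"
      using seg by (auto simp: closed_segment_def)
    have "z = of_real ((1 - u) * r + u * \<rho>) * cis \<theta>"
      using u by (simp add: scaleR_conv_of_real algebra_simps)
    moreover have "(1 - u) * r + u * \<rho> \<in> {\<rho>..r}"
    proof -
      have "(1 - u) * \<rho> \<le> (1 - u) * r" "u * \<rho> \<le> u * r" using u \<rho> by (auto intro!: mult_left_mono)
      then show ?thesis by (auto simp: algebra_simps)
    qed
    ultimately show ?thesis by blast
  qed
  have P: "path P" "pathstart P = of_real r * cis \<theta>\<^sub>1" "pathfinish P = of_real r * cis \<theta>\<^sub>2"
    by (auto simp: P_def cis_conv_exp)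
  \<comment> \<open>The last conjunct says that \<open>P\<close> meets the circle of radius
    \<open>r\<close> only at its two ends, so the rest maps into the image of the open disk of
    radius \<open>r\<close>.\<close>
  have P_image: "\<exists>t\<in>{\<rho>..r}. \<exists>\<theta>. \<bar>\<theta> - \<alpha>\<bar> \<le> pi * (1 - \<rho>) \<and> z = of_real t * cis \<theta>
      \<and> (t = r \<longrightarrow> \<theta> = \<theta>\<^sub>1 \<or> \<theta> = \<theta>\<^sub>2)" if z: "z \<in> path_image P" for z
  proof -
    have "path_image P \<subseteq> closed_segment (of_real r * cis \<theta>\<^sub>1) (of_real \<rho> * cis \<theta>\<^sub>1)
      \<union> (path_image (part_circlepath 0 \<rho> \<theta>\<^sub>1 \<theta>\<^sub>2)
        \<union> closed_segment (of_real r * cis \<theta>\<^sub>2) (of_real \<rho> * cis \<theta>\<^sub>2))"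
      unfolding P_def
      by (intro order_trans[OF path_image_join_subset] Un_mono) (auto simp: closed_segment_commute)
    with z consider "z \<in> closed_segment (of_real r * cis \<theta>\<^sub>1) (of_real \<rho> * cis \<theta>\<^sub>1)"
      | "z \<in> path_image (part_circlepath 0 \<rho> \<theta>\<^sub>1 \<theta>\<^sub>2)"
      | "z \<in> closed_segment (of_real r * cis \<theta>\<^sub>2) (of_real \<rho> * cis \<theta>\<^sub>2)" by blast
    then show ?thesis
    proof cases
      case 1 then show ?thesis using radial[OF 1] \<theta> by blast
    next
      case 2
      then obtain \<theta> where "\<theta> \<in> closed_segment \<theta>\<^sub>1 \<theta>\<^sub>2" "z = of_real \<rho> * cis \<theta>"
        by (auto simp: path_image_part_circlepath' cis_conv_exp)
      moreover from this have "\<bar>\<theta> - \<alpha>\<bar> \<le> pi * (1 - \<rho>)"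
        using \<theta> by (auto simp: closed_segment_eq_real_ivl split: if_splits)
      ultimately show ?thesis using \<rho> by (intro bexI[of _ \<rho>] exI[of _ \<theta>]) auto
    next
      case 3 then show ?thesis using radial[OF 3] \<theta> by blast
    qed
  qed
  have P_ball: "path_image P \<subseteq> ball 0 1"
    using P_image \<rho> by (fastforce simp: norm_mult)
  show ?thesis
  proof (rule interior_diam_dist_le_of_path[where p = "f \<circ> P" and c = "f (of_real \<rho> * cis \<alpha>)"])
    show "path (f \<circ> P)"
      using P(1) f_cont P_ball by (intro path_continuous_image) (auto intro: continuous_on_subset)
    show "pathstart (f \<circ> P) = f (of_real r * cis \<theta>\<^sub>1)" "pathfinish (f \<circ> P) = f (of_real r * cis \<theta>\<^sub>2)"
      using P by (simp_all add: pathstart_compose pathfinish_compose)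
    show "path_image (f \<circ> P) - {f (of_real r * cis \<theta>\<^sub>1), f (of_real r * cis \<theta>\<^sub>2)} \<subseteq> f ` ball 0 r"
    proof
      fix w assume w: "w \<in> path_image (f \<circ> P) - {f (of_real r * cis \<theta>\<^sub>1), f (of_real r * cis \<theta>\<^sub>2)}"
      then obtain z where z: "z \<in> path_image P" "w = f z" by (auto simp: path_image_compose)
      obtain t \<theta> where t: "t \<in> {\<rho>..r}" "z = of_real t * cis \<theta>" "t = r \<longrightarrow> \<theta> = \<theta>\<^sub>1 \<or> \<theta> = \<theta>\<^sub>2"
        using P_image[OF z(1)] by blast
      then have "t \<noteq> r" using w z by auto
      then have "z \<in> ball 0 r" using t \<rho> by (auto simp: norm_mult)
      then show "w \<in> f ` ball 0 r" using z by blast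
    qed
    fix w assume "w \<in> path_image (f \<circ> P)"
    then obtain z where z: "z \<in> path_image P" "w = f z" by (auto simp: path_image_compose)
    obtain t \<theta> where t: "t \<in> {\<rho>..r}" "\<bar>\<theta> - \<alpha>\<bar> \<le> pi * (1 - \<rho>)" "z = of_real t * cis \<theta>"
      using P_image[OF z(1)] by blast
    then show "dist w (f (of_real \<rho> * cis \<alpha>)) \<le> diam_const * (1 - \<rho>) * norm_D f (of_real \<rho> * cis \<alpha>)"
      using \<rho> z by (auto intro!: dist_box_le)
  qed (rule neq)
qed

text \<open>Injectivity of \<open>f\<close> fixes the endpoint angles of a competing arc up to full
  turns. Its opening below \<open>2 * pi\<close> leaves only the two arcs of the circle, and each
  has length at least \<open>r / K\<close> times its integral.\<close>

lemma shorter_subarc_length_ge: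
  assumes r: "0 < r" "r < 1" and as: "a < s" "s < a + 2 * pi"
  shows "ennreal (r / K * min (integral {a..s} (\<lambda>t. norm_D f (of_real r * cis t)))
      (integral {s..a + 2 * pi} (\<lambda>t. norm_D f (of_real r * cis t))))
    \<le> shorter_subarc_length f r (f (of_real r * cis a)) (f (of_real r * cis s))"
  unfolding shorter_subarc_length_def
proof (rule INF_greatest, clarify)
  let ?\<phi> = "\<lambda>t. norm_D f (of_real r * cis t)"
  fix a' s'
  assume lt: "\<bar>s' - a'\<bar> < 2 * pi"
    and start: "pathstart (f \<circ> part_circlepath 0 r a' s') = f (of_real r * cis a)"
    and finish: "pathfinish (f \<circ> part_circlepath 0 r a' s') = f (of_real r * cis s)"
  have on_circle: "\<exists>k::int. b = c + 2 * pi * of_int k"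
    if "f (of_real r * cis b) = f (of_real r * cis c)" for b c
  proof -
    have "complex_of_real r * cis b = of_real r * cis c"
      using inj_onD[OF inj that] r by (simp add: norm_mult)
    then show ?thesis using r by (simp add: cis_eq_cis_iff)
  qed
  obtain k where k: "a' = a + 2 * pi * of_int k"
    using on_circle[of a' a] start by (auto simp: pathstart_compose cis_conv_exp)
  obtain l where l: "s' = s + 2 * pi * of_int l"
    using on_circle[of s' s] finish by (auto simp: pathfinish_compose cis_conv_exp)
  note shift = integral_periodic_shift[of ?\<phi>, OF norm_D_circle_periodic]
  \<comment> \<open>As \<open>s - a\<close> lies strictly between 0 and \<open>2 * pi\<close>, a
    competitor either follows the given arc or runs the complementary way, one full turn
    less.\<close>
  have "l - k = 0 \<or> l - k = -1"
  proof -
    have eq: "s' - a' = (s - a) + 2 * pi * of_int (l - k)" by (simp add: k l algebra_simps)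
    have "of_int (l - k) < (1::real)"
    proof (rule ccontr)
      assume "\<not> ?thesis"
      then have "2 * pi * 1 \<le> 2 * pi * of_int (l - k)" by (intro mult_left_mono) auto
      then show False using lt as eq by linarith
    qed
    moreover have "(-2::real) < of_int (l - k)"
    proof (rule ccontr)
      assume "\<not> ?thesis"
      then have "2 * pi * of_int (l - k) \<le> 2 * pi * (-2)" by (intro mult_left_mono) auto
      then show False using lt as eq by linarith
    qed
    ultimately show ?thesis by linarith
  qed
  then have cases: "a' \<noteq> s' \<and> min (integral {a..s} ?\<phi>) (integral {s..a + 2 * pi} ?\<phi>)
      \<le> integral {min a' s'..max a' s'} ?\<phi>"
  proof
    assume "l - k = 0"
    then have "l = k" by simp
    then have "a' < s'" "integral {a'..s'} ?\<phi> = integral {a..s} ?\<phi>"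
      using as by (auto simp: k l shift)
    then show ?thesis by simp
  next
    assume "l - k = -1"
    then have "k = l + 1" by simp
    then have a'_eq: "a' = (a + 2 * pi) + 2 * pi * of_int l" by (simp add: k algebra_simps)
    then have "s' < a'" using as by (simp add: l)
    moreover have "integral {s'..a'} ?\<phi> = integral {s..a + 2 * pi} ?\<phi>"
      unfolding a'_eq l by (rule shift)
    ultimately show ?thesis by simp
  qed
  then have ne: "a' \<noteq> s'" by simp
  have le: "r / K * min (integral {a..s} ?\<phi>) (integral {s..a + 2 * pi} ?\<phi>)
      \<le> r / K * integral {min a' s'..max a' s'} ?\<phi>"
  proof (rule mult_left_mono)
    show "min (integral {a..s} ?\<phi>) (integral {s..a + 2 * pi} ?\<phi>) \<le> integral {min a' s'..max a' s'} ?\<phi>"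
      using cases ..
  qed (use r K(1) in auto)
  show "ennreal (r / K * min (integral {a..s} ?\<phi>) (integral {s..a + 2 * pi} ?\<phi>))
      \<le> path_length (f \<circ> part_circlepath 0 r a' s')"
    using order_trans[OF ennreal_leI[OF le] path_length_circle_arc_ge[OF K(2,1) _ r(2) ne]] r(1) by simp
qed

text \<open>The 8 collects three factors 2: the halving of the integral, the bound
  \<open>r \<ge> 1 / 2\<close>, and diameter against radius in
  \<open>interior_diam_dist_le\<close>.\<close>

definition arc_const :: real where "arc_const = 8 * K * M * diam_const"

lemma arc_const_pos: "0 < arc_const"
  unfolding arc_const_def using K(1) M(1) diam_const_pos by simp

text \<open>The arc is cut at the point \<open>s\<close> that halves the integral. Then both arcs of the circle between
  its first endpoint and \<open>s\<close> carry at least half of it, so it does not matter which one is shorter.\<close>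

lemma integral_arc_le:
  assumes \<rho>: "0 \<le> \<rho>" "\<rho> < r" "r < 1" and r: "1 / 2 \<le> r"
  shows "integral {\<alpha> - pi * (1 - \<rho>)..\<alpha> + pi * (1 - \<rho>)} (\<lambda>t. norm_D f (of_real r * cis t))
    \<le> arc_const * (1 - \<rho>) * norm_D f (of_real \<rho> * cis \<alpha>)"
proof -
  let ?\<phi> = "\<lambda>t. norm_D f (of_real r * cis t)"
  let ?D = "diam_const * (1 - \<rho>) * norm_D f (of_real \<rho> * cis \<alpha>)"
  define a where "a = \<alpha> - pi * (1 - \<rho>)"
  define b where "b = \<alpha> + pi * (1 - \<rho>)"
  define I where "I = integral {a..b} ?\<phi>"
  have int: "?\<phi> integrable_on {c..d}" for c d
    using \<rho> by (intro norm_D_circle_integrable) auto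
  have ab: "a \<le> b" using \<rho> by (simp add: a_def b_def)
  \<comment> \<open>The interval \<open>{a..b}\<close> covers at most one turn, so the complementary
    arc from \<open>s\<close> to \<open>a + 2 * pi\<close> contains \<open>{s..b}\<close>.\<close>
  have b_le: "b \<le> a + 2 * pi" using \<rho> by (simp add: a_def b_def algebra_simps)
  have D: "0 \<le> ?D" using \<rho> diam_const_pos norm_D_nonneg by simp
  have "I \<le> arc_const * (1 - \<rho>) * norm_D f (of_real \<rho> * cis \<alpha>)"
  proof (cases "I \<le> 0")
    case True
    also have "0 \<le> arc_const * (1 - \<rho>) * norm_D f (of_real \<rho> * cis \<alpha>)"
      using \<rho> arc_const_pos norm_D_nonneg by simp
    finally show ?thesis .
  next
    case False
    then obtain s where s: "s \<in> {a..b}" "integral {a..s} ?\<phi> = I / 2" "integral {s..b} ?\<phi> = I / 2"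
      using exists_half_integral[OF ab int] unfolding I_def by (metis less_eq_real_def not_le)
    have "a \<noteq> s" "s \<noteq> b" using s False by auto
    then have as: "a < s" "s < a + 2 * pi" using s(1) b_le by auto
    have "integral {s..a + 2 * pi} ?\<phi> = integral {s..b} ?\<phi> + integral {b..a + 2 * pi} ?\<phi>"
      using s(1) b_le by (intro Henstock_Kurzweil_Integration.integral_combine[symmetric] int) auto
    moreover have "0 \<le> integral {b..a + 2 * pi} ?\<phi>"
      by (intro integral_nonneg int norm_D_nonneg)
    ultimately have min_eq: "min (integral {a..s} ?\<phi>) (integral {s..a + 2 * pi} ?\<phi>) = I / 2"
      using s by simp
    let ?w1 = "f (of_real r * cis a)" and ?w2 = "f (of_real r * cis s)"
    have neq: "?w1 \<noteq> ?w2"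
    proof
      assume eq: "?w1 = ?w2"
      have "complex_of_real r * cis a = of_real r * cis s"
        using inj_onD[OF inj eq] \<rho> by (simp add: norm_mult)
      then obtain k :: int where k: "s = a + 2 * pi * of_int k"
        using r by (metis cis_eq_cis_iff mult_cancel_left of_real_eq_0_iff not_one_le_zero half_gt_zero_iff less_le_not_le zero_less_one)
      then have "0 < 2 * pi * of_int k" "2 * pi * of_int k < 2 * pi * 1" using as by auto
      then have "0 < k" "k < 1"
        by (simp_all only: mult_less_cancel_left_pos zero_less_mult_iff) auto
      then show False by simp
    qed
    have dist_le: "interior_diam_dist (f ` ball 0 r) ?w1 ?w2 \<le> ennreal (2 * ?D)"
      using \<rho> s(1) neq by (intro interior_diam_dist_le) (auto simp: a_def b_def abs_le_iff)
    have "ennreal (r / K * (I / 2)) \<le> shorter_subarc_length f r ?w1 ?w2"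
      using shorter_subarc_length_ge[of r a s] \<rho> r as unfolding min_eq by simp
    also have "\<dots> \<le> ennreal M * interior_diam_dist (f ` ball 0 r) ?w1 ?w2"
    proof -
      have "?w1 \<in> f ` sphere 0 r" "?w2 \<in> f ` sphere 0 r - {?w1}"
        using neq r by (auto intro!: imageI simp: norm_mult)
      then have quot: "shorter_subarc_length f r ?w1 ?w2 / interior_diam_dist (f ` ball 0 r) ?w1 ?w2 \<le> ennreal M"
        using \<rho> by (intro M(2)) auto
      have fin: "interior_diam_dist (f ` ball 0 r) ?w1 ?w2 < \<infinity>"
        using dist_le by (auto intro: le_less_trans)
      show ?thesis
      \<comment> \<open>In \<open>ennreal\<close> a nonzero number divided by 0 is infinite, so the
        finite quotient forces the length to vanish when the distance does.\<close>
      proof (cases "interior_diam_dist (f ` ball 0 r) ?w1 ?w2 = 0")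
        case True
        then show ?thesis using quot by (auto simp: top_unique split: if_splits)
      next
        case False
        then have "shorter_subarc_length f r ?w1 ?w2
            = shorter_subarc_length f r ?w1 ?w2 / interior_diam_dist (f ` ball 0 r) ?w1 ?w2
              * interior_diam_dist (f ` ball 0 r) ?w1 ?w2"
          using fin by (simp add: ennreal_divide_times)
        also have "\<dots> \<le> ennreal M * interior_diam_dist (f ` ball 0 r) ?w1 ?w2"
          using quot by (rule mult_right_mono) simp
        finally show ?thesis .
      qed
    qed
    also have "\<dots> \<le> ennreal M * ennreal (2 * ?D)" using dist_le by (rule mult_left_mono) simp
    also have "\<dots> = ennreal (M * (2 * ?D))" using M(1) D by (simp add: ennreal_mult)
    finally have "r / K * (I / 2) \<le> M * (2 * ?D)"
      using M(1) D by (subst (asm) ennreal_le_iff) auto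
    moreover have "1 / 2 / K * (I / 2) \<le> r / K * (I / 2)"
      using r K(1) False by (intro mult_right_mono divide_right_mono) auto
    ultimately have "1 / 2 / K * (I / 2) \<le> M * (2 * ?D)" by linarith
    then have "I \<le> K * (8 * (M * ?D))"
      using K(1) by (simp add: field_simps)
    then show ?thesis by (simp add: arc_const_def mult_ac)
  qed
  then show ?thesis by (simp add: I_def a_def b_def)
qed

section \<open>Uniform Poisson bounds and passage to the boundary\<close>

definition poisson_const :: real where
  "poisson_const = 8 * 2 powr (1 - (q / 2 - 1)) / (1 - 2 powr (q / 2 - 1 - 1)) * (arc_const * (2 * 2 powr (1 + q / 2)))"

text \<open>The arc of half-length \<open>pi * x\<close> belongs to the point of radius
  \<open>1 - x\<close> on the same ray, and \<open>norm_D_radial_growth\<close> compares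
  \<open>norm_D\<close> there with its value at radius \<open>\<rho>\<close>. This gives the
  interval growth with exponent \<open>b = q / 2 - 1 < 1\<close>.\<close>

lemma poisson_integral_norm_D_le:
  assumes \<rho>: "0 \<le> \<rho>" "\<rho> < r" "r < 1" and r: "1 / 2 \<le> r"
  shows "integral {0..2 * pi} (\<lambda>t. norm_D f (of_real r * cis t) * poisson_kernel (of_real \<rho> * cis \<alpha>) t)
    \<le> poisson_const * norm_D f (of_real \<rho> * cis \<alpha>)"
proof -
  let ?\<phi> = "\<lambda>t. norm_D f (of_real r * cis t)"
  let ?P = "poisson_kernel (of_real \<rho> * cis \<alpha>)"
  let ?D = "norm_D f (of_real \<rho> * cis \<alpha>)"
  have "integral {0..2 * pi} (\<lambda>t. ?\<phi> t * ?P t) = integral {\<alpha> - pi..\<alpha> - pi + 2 * pi} (\<lambda>t. ?\<phi> t * ?P t)"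
  proof (rule integral_periodic[symmetric])
    show "continuous_on UNIV (\<lambda>t. ?\<phi> t * ?P t)"
      using \<rho> by (intro continuous_intros norm_D_circle_cont) (auto simp: norm_mult)
  qed (use cis_add_2pi_int[of _ 1] in \<open>simp add: poisson_kernel_def\<close>)
  also have "{\<alpha> - pi..\<alpha> - pi + 2 * pi} = {\<alpha> - pi..\<alpha> + pi}" by simp
  also have "integral {\<alpha> - pi..\<alpha> + pi} (\<lambda>t. ?\<phi> t * ?P t)
      \<le> 8 * 2 powr (1 - (q / 2 - 1)) / (1 - 2 powr (q / 2 - 1 - 1)) * (arc_const * (2 * 2 powr (1 + q / 2)) * ?D)"
  proof (rule poisson_integral_le_of_interval_growth)
    show "continuous_on {\<alpha> - pi..\<alpha> + pi} ?\<phi>" using \<rho> by (intro norm_D_circle_cont) auto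
    fix x assume x: "1 - \<rho> \<le> x" "x \<le> 1"
    have "integral {\<alpha> - pi * x..\<alpha> + pi * x} ?\<phi> \<le> arc_const * x * norm_D f (of_real (1 - x) * cis \<alpha>)"
      using integral_arc_le[of "1 - x" r \<alpha>] x \<rho> r by simp
    also have "\<dots> \<le> arc_const * x *
        (2 * 2 powr (1 + q / 2) * ((1 - (1 - x)) / (1 - \<rho>)) powr (q / 2 - 1) * ?D)"
      using x \<rho> arc_const_pos by (intro mult_left_mono norm_D_radial_growth) auto
    finally show "integral {\<alpha> - pi * x..\<alpha> + pi * x} ?\<phi>
        \<le> arc_const * (2 * 2 powr (1 + q / 2)) * ?D * x * (x / (1 - \<rho>)) powr (q / 2 - 1)"
      by (simp add: mult_ac)
  qed (use \<rho> q norm_D_nonneg in auto)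
  finally show ?thesis by (simp add: poisson_const_def mult_ac)
qed

text \<open>Here \<open>norm_D f\<close> is written through \<open>F\<close>, a square root of
  \<open>deriv h\<close>, and the dilatation \<open>\<omega>\<close>. The square means of
  \<open>F\<close> are bounded by \<open>integral_arc_le\<close> and those of
  \<open>\<omega>\<close> because its modulus is at most 1.\<close>

lemma radial_limit_norm_D:
  "AE t in lborel. t \<in> {0..2 * pi} \<longrightarrow>
    (\<exists>l. ((\<lambda>r. norm_D f (of_real r * cis t)) \<longlongrightarrow> l) (at_left 1))"
proof -
  obtain L where L: "L holomorphic_on ball 0 1" "\<And>z. z \<in> ball 0 1 \<Longrightarrow> deriv h z = exp (L z)"
    using holomorphic_log_h' by metis
  define F where "F z = exp (L z / 2)" for z
  define \<omega> where "\<omega> z = deriv g z / deriv h z" for z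
  have F_holo: "F holomorphic_on ball 0 1"
    unfolding F_def[abs_def] by (intro holomorphic_intros L) auto
  have \<omega>_holo: "\<omega> holomorphic_on ball 0 1"
    unfolding \<omega>_def[abs_def] using h'_nonzero by (intro holomorphic_intros g'_holo h'_holo) auto
  have F_sq: "(norm (F z))\<^sup>2 = norm (deriv h z)" if "z \<in> ball 0 1" for z
  proof -
    have "(F z)\<^sup>2 = exp (L z)" by (simp add: F_def power2_eq_square flip: exp_add)
    then show ?thesis using L(2)[OF that] by (simp flip: norm_power)
  qed
  have \<omega>_le: "norm (\<omega> z) \<le> 1" if "z \<in> ball 0 1" for z
    using g'_less_h'[OF that] h'_nonzero[OF that] by (simp add: \<omega>_def norm_divide divide_le_eq_1)
  have norm_D_F: "norm_D f z = (norm (F z))\<^sup>2 * (1 + norm (\<omega> z))" if "z \<in> ball 0 1" for z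
    using h'_nonzero[OF that] by (simp add: norm_D_eq[OF that] F_sq[OF that] \<omega>_def norm_divide algebra_simps)
  have circle: "of_real r * cis t \<in> ball 0 1" if "0 \<le> r" "r < 1" for r t
    using that by (simp add: norm_mult)
  have "AE t in lebesgue. t \<in> {0..2 * pi} \<longrightarrow> (\<exists>l. ((\<lambda>r. F (of_real r * cis t)) \<longlongrightarrow> l) (at_left 1))"
  proof (rule Fatou_radial_limit[OF F_holo, of "1 / 2"])
    fix r :: real assume r: "1 / 2 < r" "r < 1"
    have "integral {0..2 * pi} (\<lambda>t. (norm (F (of_real r * cis t)))\<^sup>2)
        \<le> integral {0..2 * pi} (\<lambda>t. norm_D f (of_real r * cis t))"
    proof (rule integral_le)
      show "(\<lambda>t. (norm (F (of_real r * cis t)))\<^sup>2) integrable_on {0..2 * pi}"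
        using r by (intro integrable_continuous_real continuous_intros continuous_on_cis_image
            holomorphic_on_imp_continuous_on F_holo) auto
      show "(\<lambda>t. norm_D f (of_real r * cis t)) integrable_on {0..2 * pi}"
        using r by (intro norm_D_circle_integrable) auto
      fix t
      have "of_real r * cis t \<in> ball 0 1" using r by (intro circle) auto
      then show "(norm (F (of_real r * cis t)))\<^sup>2 \<le> norm_D f (of_real r * cis t)"
        by (simp only: F_sq h'_le_norm_D)
    qed
    also have "\<dots> \<le> arc_const * norm_D f 0"
      \<comment> \<open>For \<open>\<rho> = 0\<close> the arc about \<open>pi\<close> is the full
        circle \<open>{0..2 * pi}\<close>.\<close>
      using integral_arc_le[of 0 r pi] r by (simp flip: mult_2)
    finally show "integral {0..2 * pi} (\<lambda>t. (norm (F (of_real r * cis t)))\<^sup>2) \<le> arc_const * norm_D f 0" .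
  qed auto
  moreover have "AE t in lebesgue. t \<in> {0..2 * pi} \<longrightarrow> (\<exists>l. ((\<lambda>r. \<omega> (of_real r * cis t)) \<longlongrightarrow> l) (at_left 1))"
  proof (rule Fatou_radial_limit[OF \<omega>_holo, of "1 / 2"])
    fix r :: real assume r: "1 / 2 < r" "r < 1"
    have "integral {0..2 * pi} (\<lambda>t. (norm (\<omega> (of_real r * cis t)))\<^sup>2) \<le> integral {0..2 * pi} (\<lambda>t. 1)"
    proof (rule integral_le)
      show "(\<lambda>t. (norm (\<omega> (of_real r * cis t)))\<^sup>2) integrable_on {0..2 * pi}"
        using r by (intro integrable_continuous_real continuous_intros continuous_on_cis_image
            holomorphic_on_imp_continuous_on \<omega>_holo) auto
      show "(norm (\<omega> (of_real r * cis t)))\<^sup>2 \<le> 1" for t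
        using \<omega>_le[OF circle[of r t]] r by (simp add: power_le_one)
    qed (rule integrable_const_ivl)
    also have "\<dots> = 2 * pi" by simp
    finally show "integral {0..2 * pi} (\<lambda>t. (norm (\<omega> (of_real r * cis t)))\<^sup>2) \<le> 2 * pi" .
  qed auto
  ultimately have "AE t in lebesgue. t \<in> {0..2 * pi} \<longrightarrow>
      (\<exists>l. ((\<lambda>r. norm_D f (of_real r * cis t)) \<longlongrightarrow> l) (at_left 1))"
  proof eventually_elim
    case (elim t)
    show ?case
    proof
      assume "t \<in> {0..2 * pi}"
      then obtain l m where lm: "((\<lambda>r. F (of_real r * cis t)) \<longlongrightarrow> l) (at_left 1)"
        "((\<lambda>r. \<omega> (of_real r * cis t)) \<longlongrightarrow> m) (at_left 1)"
        using elim by blast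
      have "((\<lambda>r. (norm (F (of_real r * cis t)))\<^sup>2 * (1 + norm (\<omega> (of_real r * cis t))))
          \<longlongrightarrow> (norm l)\<^sup>2 * (1 + norm m)) (at_left 1)"
        by (intro tendsto_intros lm)
      moreover have "\<forall>\<^sub>F r in at_left 1. (norm (F (of_real r * cis t)))\<^sup>2 * (1 + norm (\<omega> (of_real r * cis t)))
          = norm_D f (of_real r * cis t)"
      proof (rule eventually_mono[OF eventually_at_left_real[of 0 "1::real"]])
        fix r :: real assume "r \<in> {0<..<1}"
        then show "(norm (F (of_real r * cis t)))\<^sup>2 * (1 + norm (\<omega> (of_real r * cis t)))
            = norm_D f (of_real r * cis t)"
          using norm_D_F[OF circle[of r t]] by simp
      qed simp
      ultimately have "((\<lambda>r. norm_D f (of_real r * cis t)) \<longlongrightarrow> (norm l)\<^sup>2 * (1 + norm m)) (at_left 1)"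
        by (rule Lim_transform_eventually)
      then show "\<exists>l. ((\<lambda>r. norm_D f (of_real r * cis t)) \<longlongrightarrow> l) (at_left 1)" ..
    qed
  qed
  \<comment> \<open>Lebesgue measure is the completion of \<open>lborel\<close>, so both have the
    same notion of almost everywhere.\<close>
  then show ?thesis by (simp add: AE_completion_iff)
qed

text \<open>Along radii tending to 1 the integrals are bounded by \<open>poisson_const\<close>,
  whatever \<open>\<zeta>\<close> is. Fatou's lemma carries the bound over to the radial
  limits.\<close>

lemma poisson_integral_radial_norm_D_le:
  assumes \<zeta>: "\<zeta> \<in> ball 0 1"
  shows "(\<integral>\<^sup>+t. radial_norm_D f (cis t) / ennreal (norm_D f \<zeta>)
      * ennreal ((1 - (norm \<zeta>)\<^sup>2) / (norm (cis t - \<zeta>))\<^sup>2) * indicator {0..2 * pi} t \<partial>lborel)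
    \<le> ennreal poisson_const"
proof -
  define \<rho> where "\<rho> = norm \<zeta>"
  define D where "D = norm_D f \<zeta>"
  \<comment> \<open>These radii tend to 1 while exceeding \<open>\<rho>\<close> and staying at least
    1/2, as \<open>poisson_integral_norm_D_le\<close> requires.\<close>
  define R where "R n = 1 - (1 - \<rho>) / real (n + 2)" for n
  have \<zeta>_eq: "\<zeta> = of_real \<rho> * cis (Arg \<zeta>)"
    using rcis_cmod_Arg[of \<zeta>] by (simp add: \<rho>_def rcis_def)
  have \<rho>: "0 \<le> \<rho>" "\<rho> < 1" using \<zeta> by (auto simp: \<rho>_def)
  have D: "0 < D" unfolding D_def by (rule norm_D_pos[OF \<zeta>])
  have R: "\<rho> < R n" "R n < 1" "1 / 2 \<le> R n" for n
  proof -
    define e where "e = (1 - \<rho>) / real (n + 2)"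
    have "e \<le> (1 - \<rho>) / 2" unfolding e_def using \<rho> by (intro divide_left_mono) auto
    moreover have "0 < e" unfolding e_def using \<rho> by simp
    moreover have "R n = 1 - e" by (simp add: R_def e_def)
    ultimately have "\<rho> < R n \<and> R n < 1 \<and> 1 / 2 \<le> R n"
      using \<rho> by (simp add: field_simps)
    then show "\<rho> < R n" "R n < 1" "1 / 2 \<le> R n" by auto
  qed
  have R_lim: "filterlim R (at_left 1) sequentially"
    unfolding filterlim_at
  proof
    show "R \<longlonglongrightarrow> 1" unfolding R_def by real_asymp
    show "\<forall>\<^sub>F n in sequentially. R n \<in> {..<1} \<and> R n \<noteq> 1"
      using R(2) by (auto simp: less_imp_neq)
  qed
  let ?P = "poisson_kernel \<zeta>"
  have P_nonneg: "0 \<le> ?P t" for t using \<rho> by (intro poisson_kernel_nonneg) (simp add: \<rho>_def)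
  define v where "v n t = norm_D f (of_real (R n) * cis t) / D * ?P t" for n t
  have v_nonneg: "0 \<le> v n t" for n t
    unfolding v_def using D norm_D_nonneg P_nonneg by simp
  have v_cont: "continuous_on S (v n)" for n S
    unfolding v_def[abs_def] using D R(2)[of n] less_imp_le[OF le_less_trans[OF \<rho>(1) R(1)[of n]]] \<zeta>
    by (intro continuous_intros norm_D_circle_cont) auto
  have [measurable]: "v n \<in> borel_measurable borel" for n
    by (rule borel_measurable_continuous_onI[OF v_cont])
  have "(\<integral>\<^sup>+t. radial_norm_D f (cis t) / ennreal (norm_D f \<zeta>)
      * ennreal ((1 - (norm \<zeta>)\<^sup>2) / (norm (cis t - \<zeta>))\<^sup>2) * indicator {0..2 * pi} t \<partial>lborel)
    = (\<integral>\<^sup>+t. liminf (\<lambda>n. ennreal (v n t) * indicator {0..2 * pi} t) \<partial>lborel)"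
  \<comment> \<open>\<open>Lim\<close> has a meaning only where the limit exists, so the two
    integrands agree only almost everywhere. The \<open>liminf\<close> of the continuous functions
    \<open>v n\<close> is the form to which Fatou's lemma applies.\<close>
  proof (rule nn_integral_cong_AE, rule AE_mp[OF radial_limit_norm_D], intro AE_I2 impI)
    fix t assume ex: "t \<in> {0..2 * pi} \<longrightarrow> (\<exists>l. ((\<lambda>r. norm_D f (of_real r * cis t)) \<longlongrightarrow> l) (at_left 1))"
    show "radial_norm_D f (cis t) / ennreal (norm_D f \<zeta>)
        * ennreal ((1 - (norm \<zeta>)\<^sup>2) / (norm (cis t - \<zeta>))\<^sup>2) * indicator {0..2 * pi} t
      = liminf (\<lambda>n. ennreal (v n t) * indicator {0..2 * pi} t)"
    proof (cases "t \<in> {0..2 * pi}")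
      case True
      then obtain l where l: "((\<lambda>r. norm_D f (of_real r * cis t)) \<longlongrightarrow> l) (at_left 1)" using ex by blast
      have "radial_norm_D f (cis t) = ennreal l"
        unfolding radial_norm_D_def by (intro tendsto_Lim tendsto_ennrealI l) simp
      moreover have "0 \<le> l"
        by (rule tendsto_lowerbound[OF l]) (auto simp: norm_D_nonneg)
      ultimately have "radial_norm_D f (cis t) / ennreal D * ennreal (?P t) = ennreal (l / D * ?P t)"
        using D P_nonneg[of t] by (simp only: divide_ennreal ennreal_mult divide_nonneg_pos)
      moreover have "(\<lambda>n. v n t) \<longlonglongrightarrow> l / D * ?P t"
        unfolding v_def using D by (intro tendsto_intros filterlim_compose[OF l R_lim]) auto
      then have "liminf (\<lambda>n. ennreal (v n t)) = ennreal (l / D * ?P t)"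
        by (intro lim_imp_Liminf tendsto_ennrealI) auto
      ultimately show ?thesis using True by (simp add: D_def poisson_kernel_def)
    qed (simp add: Liminf_const)
  qed
  also have "\<dots> \<le> liminf (\<lambda>n. \<integral>\<^sup>+t. ennreal (v n t) * indicator {0..2 * pi} t \<partial>lborel)"
    by (intro nn_integral_liminf) measurable
  also have "\<dots> \<le> liminf (\<lambda>n. ennreal poisson_const)"
  proof (intro Liminf_mono always_eventually allI)
    fix n
    have R0: "0 \<le> R n" using \<rho>(1) R(1)[of n] by simp
    have int: "v n integrable_on {0..2 * pi}" by (intro integrable_continuous_real v_cont)
    have "(\<integral>\<^sup>+t. ennreal (v n t) * indicator {0..2 * pi} t \<partial>lborel) = ennreal (integral {0..2 * pi} (v n))"
      using v_nonneg int by (intro nn_integral_has_integral_lebesgue' integrable_integral) auto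
    also have "integral {0..2 * pi} (v n)
        = integral {0..2 * pi} (\<lambda>t. norm_D f (of_real (R n) * cis t) * ?P t) / D"
      by (simp add: v_def[abs_def] flip: integral_divide)
    also have "\<dots> \<le> poisson_const * D / D"
      using poisson_integral_norm_D_le[of \<rho> "R n" "Arg \<zeta>"] \<rho> R[of n] D
      by (intro divide_right_mono) (auto simp: D_def simp flip: \<zeta>_eq)
    also have "\<dots> = poisson_const" using D by simp
    finally show "(\<integral>\<^sup>+t. ennreal (v n t) * indicator {0..2 * pi} t \<partial>lborel) \<le> ennreal poisson_const"
      by (simp add: ennreal_leI)
  qed
  also have "\<dots> = ennreal poisson_const" by (simp add: Liminf_const)
  finally show ?thesis .
qed

end

section \<open>Derivation of the locale assumptions and the final supremum\<close>

lemma S_H2_qc_imp_map: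
  assumes f: "f \<in> S_H2_qc K G" and K: "K \<ge> 1" and P: "pommerenke_interior_domain f G"
    and \<delta>: "0 < \<delta>" and C: "0 < C"
    and growth: "\<And>\<zeta> \<rho>\<^sub>1 \<rho>\<^sub>2. \<zeta> \<in> sphere 0 1 \<Longrightarrow> 0 \<le> \<rho>\<^sub>1 \<Longrightarrow> \<rho>\<^sub>1 \<le> \<rho>\<^sub>2 \<Longrightarrow> \<rho>\<^sub>2 < 1 \<Longrightarrow>
      norm_D f (of_real \<rho>\<^sub>2 * \<zeta>) \<le> C * ((1 - \<rho>\<^sub>2) / (1 - \<rho>\<^sub>1)) powr (\<delta> - 1) * norm_D f (of_real \<rho>\<^sub>1 * \<zeta>)"
  shows "\<exists>h g q M. pommerenke_growth_map f h g q K M C \<delta>"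
proof -
  let ?Q = "\<lambda>h z. norm (of_real (1 - (norm z)\<^sup>2) * (deriv (deriv h) z / deriv h z) - 2 * cnj z)"
  have S: "f \<in> S_H" "f \<in> S_H2" and qc: "quasiconformal K (ball 0 1) G f"
    using f by (auto simp: S_H2_qc_def S_H2_def)
  obtain h g where dec: "canonical_decomposition f h g" and sup: "(SUP z\<in>ball 0 1. ereal (?Q h z)) < 4"
    using S(2) by (auto simp: S_H2_def)
  \<comment> \<open>Since the supremum is strictly below 4, a real bound fits strictly in
    between.\<close>
  obtain q\<^sub>0 where q0: "(SUP z\<in>ball 0 1. ereal (?Q h z)) < ereal q\<^sub>0" "ereal q\<^sub>0 < 4"
    using ereal_dense2[OF sup] by blast
  \<comment> \<open>Raising the bound to at least 3 keeps it below 4 and puts the exponent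
    \<open>q / 2 - 1\<close> strictly between 0 and 1.\<close>
  define q where "q = max q\<^sub>0 3"
  interpret harmonic_map f h g
    by standard (use dec S(1) in \<open>auto simp: S_H_def\<close>)
  have Q_le: "?Q h z \<le> q" if "z \<in> ball 0 1" for z
    using SUP_lessD[OF q0(1) that] by (simp add: q_def)
  have q: "2 < q" "q < 4" using q0(2) by (auto simp: q_def)
  have dist: "AE z in lebesgue. z \<in> ball 0 1 \<longrightarrow> (norm_D f z)\<^sup>2 \<le> K * \<bar>jacobian f z\<bar>"
    using qc by (auto simp: quasiconformal_def elim!: eventually_mono)
  let ?R = "\<lambda>r w1 w2. shorter_subarc_length f r w1 w2 / interior_diam_dist (f ` ball 0 r) w1 w2"
  let ?S = "SUP r\<in>{0<..<1}. SUP w1\<in>f ` sphere 0 r. SUP w2\<in>f ` sphere 0 r - {w1}. ?R r w1 w2"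
  have "?S < \<infinity>" using P by (simp add: pommerenke_interior_domain_def)
  then obtain M\<^sub>0 where M0: "?S = ennreal M\<^sub>0" "0 \<le> M\<^sub>0" by (cases ?S) auto
  have ratio_le: "?R r w1 w2 \<le> ennreal (M\<^sub>0 + 1)"
    if "0 < r" "r < 1" "w1 \<in> f ` sphere 0 r" "w2 \<in> f ` sphere 0 r - {w1}" for r w1 w2
  proof -
    have "?R r w1 w2 \<le> (SUP w2\<in>f ` sphere 0 r - {w1}. ?R r w1 w2)"
      using that(4) by (rule SUP_upper)
    also have "\<dots> \<le> (SUP w1\<in>f ` sphere 0 r. SUP w2\<in>f ` sphere 0 r - {w1}. ?R r w1 w2)"
      using that(3) by (rule SUP_upper)
    also have "\<dots> \<le> ?S"
      by (rule SUP_upper) (use that in auto)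
    also have "\<dots> \<le> ennreal (M\<^sub>0 + 1)" unfolding M0(1) by (intro ennreal_leI) simp
    finally show ?thesis .
  qed
  \<comment> \<open>The added 1 makes the Pommerenke constant positive even if the supremum is
    0.\<close>
  have "pommerenke_growth_map f h g q K (M\<^sub>0 + 1) C \<delta>"
    by unfold_locales
      (use q Q_le K distortion_everywhere[OF dist] M0(2) ratio_le \<delta> C growth[of "cis _"] in auto)
  then show ?thesis by blast
qed

theorem theorem5:
  fixes K :: real and G :: "complex set" and f :: "complex \<Rightarrow> complex"
    and \<delta>\<^sub>2 C\<^sub>5 :: real
  assumes "K \<ge> 1"
    and "f \<in> S_H2_qc K G"
    and "bounded_pommerenke_interior_domain f G"
    and "0 < \<delta>\<^sub>2" and "\<delta>\<^sub>2 < 1" and "C\<^sub>5 > 0"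
    and "\<And>\<zeta> \<rho>\<^sub>1 \<rho>\<^sub>2. \<zeta> \<in> sphere 0 1 \<Longrightarrow> 0 \<le> \<rho>\<^sub>1 \<Longrightarrow> \<rho>\<^sub>1 \<le> \<rho>\<^sub>2 \<Longrightarrow> \<rho>\<^sub>2 < 1 \<Longrightarrow>
           norm_D f (of_real \<rho>\<^sub>2 * \<zeta>)
             \<le> C\<^sub>5 * ((1 - \<rho>\<^sub>2) / (1 - \<rho>\<^sub>1)) powr (\<delta>\<^sub>2 - 1) * norm_D f (of_real \<rho>\<^sub>1 * \<zeta>)"
  shows "(SUP \<zeta>\<in>ball (0::complex) 1.
            ennreal (1 / (2 * pi)) *
            (\<integral>\<^sup>+\<theta>. radial_norm_D f (cis \<theta>) / ennreal (norm_D f \<zeta>)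
                    * ennreal ((1 - (norm \<zeta>)\<^sup>2) / (norm (cis \<theta> - \<zeta>))\<^sup>2)
                    * indicator {0..2 * pi} \<theta> \<partial>lborel)) < \<infinity>"
proof -
  have P: "pommerenke_interior_domain f G"
    using assms(3) by (simp add: bounded_pommerenke_interior_domain_def)
  obtain h g q M where map: "pommerenke_growth_map f h g q K M C\<^sub>5 \<delta>\<^sub>2"
    using S_H2_qc_imp_map[OF assms(2,1) P assms(4,6,7)] by blast
  interpret pommerenke_growth_map f h g q K M C\<^sub>5 \<delta>\<^sub>2 by (rule map)
  have "(SUP \<zeta>\<in>ball (0::complex) 1.
            ennreal (1 / (2 * pi)) *
            (\<integral>\<^sup>+\<theta>. radial_norm_D f (cis \<theta>) / ennreal (norm_D f \<zeta>)
                    * ennreal ((1 - (norm \<zeta>)\<^sup>2) / (norm (cis \<theta> - \<zeta>))\<^sup>2)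
                    * indicator {0..2 * pi} \<theta> \<partial>lborel)) \<le> ennreal (1 / (2 * pi)) * ennreal poisson_const"
    by (intro SUP_least mult_left_mono poisson_integral_radial_norm_D_le) auto
  also have "\<dots> < \<infinity>" by (simp add: ennreal_mult_less_top)
  finally show ?thesis .
qed

end
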